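(* There exists a finitely generated residually finite group that has computable finite quotients (CFQ) but has unsolvable word problem.
   Context: Let $G$ be a group generated by a finite set $S$. A marked finite group is a pair $(F,f)$ with $F$ a finite group (given by its multiplication table) and $f:S\to F$ a function. $G$ has CFQ (computable finite quotients) if there is an algorithm which, given $(F,f)$, decides whether $f$ extends to a group homomorphism $G\to F$. This property does not depend on the choice of the finite generating set $S$. *)

theory Defs
  imports "HOL-Algebra.Algebra" "HOL-Library.Nat_Bijection"
begin

datatype recf = Z | S | Id nat | Cn recf "recf list" | Pr recf recf | Mn recf

inductive evalr :: "recf \<Rightarrow> nat list \<Rightarrow> nat \<Rightarrow> bool" where
  evZ: "evalr Z xs 0"
| evS: "evalr S (x # xs) (Suc x)"
| evId: "i < length xs \<Longrightarrow> evalr (Id i) xs (xs ! i)"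
| evCn: "list_all2 (\<lambda>g y. evalr g xs y) gs ys \<Longrightarrow> evalr f ys z \<Longrightarrow> evalr (Cn f gs) xs z"
| evPr0: "evalr f xs y \<Longrightarrow> evalr (Pr f g) (0 # xs) y"
| evPrS: "evalr (Pr f g) (n # xs) y \<Longrightarrow> evalr g (n # y # xs) z \<Longrightarrow> evalr (Pr f g) (Suc n # xs) z"
| evMn: "evalr f (n # xs) 0 \<Longrightarrow> (\<forall>m<n. \<exists>y. evalr f (m # xs) y \<and> y \<noteq> 0) \<Longrightarrow> evalr (Mn f) xs n"

definition computable :: "(nat \<Rightarrow> nat) \<Rightarrow> bool" where
  "computable d \<longleftrightarrow> (\<exists>r. \<forall>x. evalr r [x] (d x))"

text \<open>A word is a list of nonzero integers: k > 0 stands for s!(k-1), k < 0 for the inverse of s!(-k-1).\<close>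
definition valid_word :: "nat \<Rightarrow> int list \<Rightarrow> bool" where
  "valid_word n w \<longleftrightarrow> (\<forall>k\<in>set w. k \<noteq> 0 \<and> \<bar>k\<bar> \<le> int n)"

definition letter_val :: "('a, 'b) monoid_scheme \<Rightarrow> 'a list \<Rightarrow> int \<Rightarrow> 'a" where
  "letter_val G s k = (if k > 0 then s ! nat (k - 1) else inv\<^bsub>G\<^esub> (s ! nat (- k - 1)))"

definition word_val :: "('a, 'b) monoid_scheme \<Rightarrow> 'a list \<Rightarrow> int list \<Rightarrow> 'a" where
  "word_val G s w = foldr (\<lambda>k x. letter_val G s k \<otimes>\<^bsub>G\<^esub> x) w \<one>\<^bsub>G\<^esub>"

definition word_code :: "int list \<Rightarrow> nat" where
  "word_code w = list_encode (map int_encode w)"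

definition solvable_WP :: "('a, 'b) monoid_scheme \<Rightarrow> 'a list \<Rightarrow> bool" where
  "solvable_WP G s \<longleftrightarrow> (\<exists>d. computable d \<and>
     (\<forall>w. valid_word (length s) w \<longrightarrow> (d (word_code w) = 1 \<longleftrightarrow> word_val G s w = \<one>\<^bsub>G\<^esub>)))"

definition table_monoid :: "nat \<Rightarrow> nat list \<Rightarrow> nat monoid" where
  "table_monoid m t = \<lparr>partial_object.carrier = {0..<m}, monoid.mult = (\<lambda>a b. t ! (a * m + b)),
     monoid.one = (SOME e. e < m \<and> (\<forall>x<m. t ! (e * m + x) = x \<and> t ! (x * m + e) = x))\<rparr>"

text \<open>A marked finite group (F,f) with f : S -> F, S given as list s of length n, f as list fs.\<close>
definition valid_marked :: "nat \<Rightarrow> nat \<Rightarrow> nat list \<Rightarrow> nat list \<Rightarrow> bool" where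
  "valid_marked n m t fs \<longleftrightarrow> length t = m * m \<and> group (table_monoid m t) \<and>
     length fs = n \<and> set fs \<subseteq> {0..<m}"

definition marked_code :: "nat \<Rightarrow> nat list \<Rightarrow> nat list \<Rightarrow> nat" where
  "marked_code m t fs = prod_encode (m, prod_encode (list_encode t, list_encode fs))"

definition extends_hom :: "('a, 'b) monoid_scheme \<Rightarrow> 'a list \<Rightarrow> nat monoid \<Rightarrow> nat list \<Rightarrow> bool" where
  "extends_hom G s F fs \<longleftrightarrow> (\<exists>h \<in> hom G F. \<forall>i < length s. h (s ! i) = fs ! i)"

definition CFQ :: "('a, 'b) monoid_scheme \<Rightarrow> 'a list \<Rightarrow> bool" where
  "CFQ G s \<longleftrightarrow> (\<exists>d. computable d \<and>
     (\<forall>m t fs. valid_marked (length s) m t fs \<longrightarrow>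
        (d (marked_code m t fs) = 1 \<longleftrightarrow> extends_hom G s (table_monoid m t) fs)))"

definition residually_finite :: "('a, 'b) monoid_scheme \<Rightarrow> bool" where
  "residually_finite G \<longleftrightarrow> (\<forall>x \<in> carrier G. x \<noteq> \<one>\<^bsub>G\<^esub> \<longrightarrow>
     (\<exists>N. N \<lhd> G \<and> finite (rcosets\<^bsub>G\<^esub> N) \<and> x \<notin> N))"

end

theory Submission
  imports Defs
begin

text \<open>
  For a set \<open>R\<close> of words, let \<open>G\<close> be the group of all words modulo those that are trivial in every
  finite marked group satisfying \<open>R\<close>. It is residually finite, and its finite marked quotients are
  exactly the finite marked groups satisfying \<open>R\<close>. We take the relators
  \<open>v\<^sub>x = [a\<^sup>x b a\<^sup>-\<^sup>x, c]\<close> with \<open>x = 0\<close> or \<open>x = (k+1)! + (k+2+t)!\<close>, where program \<open>k\<close> on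
  input \<open>k\<close> has not returned \<open>0\<close> by stage \<open>t\<close>. In a group of order \<open>m\<close> the value of \<open>v\<^sub>x\<close> only
  depends on \<open>x\<close> modulo \<open>m\<close>, so finitely many relators have to be checked and \<open>G\<close> has CFQ.
  If \<open>k\<close> never returns \<open>0\<close>, then \<open>v\<^sub>x\<close> with \<open>x = (k+1)!\<close> is a profinite limit of relators and hence
  trivial in \<open>G\<close>. Otherwise some modulus \<open>n = N!\<close> separates \<open>(k+1)!\<close> from all exponents, and \<open>v\<^sub>x\<close> is
  nontrivial in the symmetric group on \<open>n + 2\<close> points, with \<open>a\<close> an \<open>n\<close>-cycle and \<open>b\<close>, \<open>c\<close>
  transpositions. So a solution of the word problem would solve the halting problem.
\<close>

section \<open>Closure properties of computable functions\<close>

lemma evalr_deterministic: "evalr r xs y \<Longrightarrow> evalr r xs z \<Longrightarrow> y = z"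
proof (induction arbitrary: z rule: evalr.induct)
  case (evZ xs)
  then show ?case by (auto elim: evalr.cases)
next
  case (evS x xs)
  then show ?case by (auto elim: evalr.cases)
next
  case (evId i xs)
  from evId(2) show ?case by cases auto
next
  case (evCn xs gs ys f y)
  from evCn(4) obtain zs where zs: "list_all2 (\<lambda>g y. evalr g xs y) gs zs" "evalr f zs z"
    by cases auto
  have "ys = zs"
    using evCn(1) zs(1) by (auto simp: list_all2_conv_all_nth intro!: nth_equalityI)
  then show ?case using evCn zs by blast
next
  case (evPr0 f xs y g)
  from evPr0(3) show ?case by cases (auto dest: evPr0.IH)
next
  case (evPrS f g n xs y w)
  from evPrS(5) show ?case
  proof cases
    case (evPrS y')
    then show ?thesis using evPrS.IH by blast
  qed
next
  case (evMn f n xs)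
  from evMn(4) show ?case
  proof cases
    case (evMn)
    \<comment> \<open>If the two minimisers differed, the smaller one would have value
      \<open>0\<close> and, as an argument passed over by the other search, also a nonzero
      value.\<close>
    then show ?thesis using evMn.IH by (metis linorder_neqE_nat)
  qed
qed

text \<open>A stepping stone: \<open>Pr\<close> and \<open>Mn\<close> act on the first argument, so
  the variable of a recursion or search is put first here. Composition then leads back to unary
  functions, and higher arities are handled by pairing.\<close>

definition computable2 :: "(nat \<Rightarrow> nat \<Rightarrow> nat) \<Rightarrow> bool" where
  "computable2 f \<longleftrightarrow> (\<exists>r. \<forall>x y. evalr r [x, y] (f x y))"

section \<open>Composition of programs and basic arithmetic\<close>

lemma evalr_Cn1: "evalr g xs y \<Longrightarrow> evalr f [y] z \<Longrightarrow> evalr (Cn f [g]) xs z"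
  by (rule evCn[of _ _ "[y]"]) auto

lemma evalr_Cn2: "evalr g xs y \<Longrightarrow> evalr h xs y' \<Longrightarrow> evalr f [y, y'] z \<Longrightarrow> evalr (Cn f [g, h]) xs z"
  by (rule evCn[of _ _ "[y, y']"]) auto

lemma evalr_Id0: "evalr (Id 0) (x # xs) x"
  using evId[of 0 "x # xs"] by simp

lemma evalr_Id1: "evalr (Id 1) (x # y # xs) y"
  using evId[of 1 "x # y # xs"] by simp

lemma evalr_Id2: "evalr (Id 2) (x # y # z # xs) z"
  using evId[of 2 "x # y # z # xs"] by simp

lemma evalr_Pr:
  assumes "evalr f xs b" and "\<And>n y. evalr g (n # y # xs) (s n y)"
  shows "evalr (Pr f g) (n # xs) (rec_nat b s n)"
  by (induction n) (auto intro: assms evalr.intros)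

lemma computable_id: "computable (\<lambda>x. x)"
  unfolding computable_def using evalr_Id0 by blast

lemma computable_comp: "computable f \<Longrightarrow> computable g \<Longrightarrow> computable (\<lambda>x. f (g x))"
  unfolding computable_def by (meson evalr_Cn1)

lemma computable2_comp:
  "computable2 f \<Longrightarrow> computable g \<Longrightarrow> computable h \<Longrightarrow> computable (\<lambda>x. f (g x) (h x))"
  unfolding computable_def computable2_def by (meson evalr_Cn2)

lemma computable_Suc0: "computable Suc"
  unfolding computable_def using evS by blast

lemmas computable_Suc = computable_comp[OF computable_Suc0]

lemma computable_const: "computable (\<lambda>_. c)"
proof (induction c)
  case 0
  then show ?case unfolding computable_def using evZ by blast
next
  case (Suc c)
  then show ?case by (rule computable_Suc)
qed

lemma computable_pred0: "computable (\<lambda>x. x - 1)"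
proof -
  have "evalr (Pr Z (Id 0)) [x] (x - 1)" for x
  proof -
    have "evalr (Pr Z (Id 0)) [x] (rec_nat 0 (\<lambda>n _. n) x)"
      by (rule evalr_Pr) (auto intro: evZ evalr_Id0)
    then show ?thesis by (cases x) auto
  qed
  then show ?thesis unfolding computable_def by blast
qed

lemma computable2_Pr:
  assumes "computable f" and "\<And>x n y. evalr g [n, y, x] (s n y x)"
  shows "computable2 (\<lambda>n x. rec_nat (f x) (\<lambda>n y. s n y x) n)"
proof -
  obtain r where r: "evalr r [x] (f x)" for x
    using assms(1) unfolding computable_def by blast
  have "evalr (Pr r g) [n, x] (rec_nat (f x) (\<lambda>n y. s n y x) n)" for n x
    by (rule evalr_Pr) (auto intro: r assms)
  then show ?thesis unfolding computable2_def by blast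
qed

lemma computable2_add: "computable2 (+)"
proof -
  have "computable2 (\<lambda>n x. rec_nat x (\<lambda>_ y. Suc y) n)"
    by (rule computable2_Pr[where g = "Cn S [Id 1]"])
      (auto intro: computable_id evalr_Cn1 evalr_Id1 evS simp del: One_nat_def)
  moreover have "rec_nat x (\<lambda>_ y. Suc y) n = n + x" for x n :: nat
    by (induction n) auto
  ultimately show ?thesis by simp
qed

text \<open>The arguments are swapped because the recursion iterates the predecessor and runs over
  the subtrahend.\<close>

lemma computable2_swapped_diff: "computable2 (\<lambda>n x. x - n)"
proof -
  obtain p where p: "evalr p [x] (x - 1)" for x
    using computable_pred0 unfolding computable_def by blast
  have "computable2 (\<lambda>n x. rec_nat x (\<lambda>_ y. y - 1) n)"
    by (rule computable2_Pr[where g = "Cn p [Id 1]"])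
      (auto intro: computable_id evalr_Cn1 evalr_Id1 p simp del: One_nat_def)
  moreover have "rec_nat x (\<lambda>_ y. y - 1) n = x - n" for x n :: nat
    by (induction n) auto
  ultimately show ?thesis by simp
qed

lemmas computable_add = computable2_comp[OF computable2_add]

lemma computable_diff: "computable f \<Longrightarrow> computable g \<Longrightarrow> computable (\<lambda>x. f x - g x)"
  by (rule computable2_comp[OF computable2_swapped_diff])

lemma computable2_mult: "computable2 (*)"
proof -
  obtain p where p: "evalr p [x, y] (x + y)" for x y
    using computable2_add unfolding computable2_def by blast
  have "computable2 (\<lambda>n x. rec_nat 0 (\<lambda>_ y. y + x) n)"
    by (rule computable2_Pr[where g = "Cn p [Id 1, Id 2]"])
      (auto intro: computable_const evalr_Cn2 evalr_Id1 evalr_Id2 p simp del: One_nat_def)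
  moreover have "rec_nat 0 (\<lambda>_ y. y + x) n = n * x" for x n :: nat
    by (induction n) auto
  ultimately show ?thesis by simp
qed

lemmas computable_mult = computable2_comp[OF computable2_mult]

lemma computable_triangle0: "computable triangle"
proof -
  obtain p where p: "evalr p [x, y] (x + y)" for x y
    using computable2_add unfolding computable2_def by blast
  have s: "evalr (Cn p [Id 1, Cn S [Id 0]]) [n, y, x] (y + Suc n)" for n y x
    by (intro evalr_Cn2[OF evalr_Id1 evalr_Cn1[OF evalr_Id0 evS]] p)
  have "computable2 (\<lambda>n x. rec_nat 0 (\<lambda>n y. y + Suc n) n)"
    by (rule computable2_Pr[OF computable_const s])
  moreover have "rec_nat 0 (\<lambda>n y. y + Suc n) n = triangle n" for n :: nat
    by (induction n) auto
  ultimately have "computable2 (\<lambda>n x. triangle n)" by simp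
  from computable2_comp[OF this computable_id computable_id] show ?thesis .
qed

lemmas computable_triangle = computable_comp[OF computable_triangle0]

lemma computable_prod_encode:
  "computable f \<Longrightarrow> computable g \<Longrightarrow> computable (\<lambda>x. prod_encode (f x, g x))"
  unfolding prod_encode_def by (simp add: computable_add computable_triangle)

lemma computable_Least:
  assumes "computable2 f" and "\<And>x. \<exists>n. f n x = 0"
  shows "computable (\<lambda>x. LEAST n. f n x = 0)"
proof -
  obtain r where r: "evalr r [n, x] (f n x)" for n x
    using assms(1) unfolding computable2_def by blast
  have "evalr (Mn r) [x] (LEAST n. f n x = 0)" for x
  proof (rule evMn)
    show "evalr r [LEAST n. f n x = 0, x] 0"
      using r[of "LEAST n. f n x = 0" x] LeastI_ex[OF assms(2)[of x]] by simp
    show "\<forall>m<LEAST n. f n x = 0. \<exists>y. evalr r [m, x] y \<and> y \<noteq> 0"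
      using r not_less_Least by blast
  qed
  then show ?thesis unfolding computable_def by blast
qed

section \<open>Computability of the inverse of the pairing function\<close>

definition pfst :: "nat \<Rightarrow> nat" where "pfst z = fst (prod_decode z)"
definition psnd :: "nat \<Rightarrow> nat" where "psnd z = snd (prod_decode z)"

lemma pfst_prod_encode [simp]: "pfst (prod_encode (x, y)) = x"
  by (simp add: pfst_def)

lemma psnd_prod_encode [simp]: "psnd (prod_encode (x, y)) = y"
  by (simp add: psnd_def)

lemma prod_encode_pfst_psnd [simp]: "prod_encode (pfst z, psnd z) = z"
  by (simp add: pfst_def psnd_def)

lemma triangle_mono: "a \<le> b \<Longrightarrow> triangle a \<le> triangle b"
  by (induction b) (auto simp: le_Suc_eq)

text \<open>The pairs with coordinate sum \<open>s\<close> have exactly the codes from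
  \<open>triangle s\<close> up to, but excluding, \<open>triangle (Suc s)\<close>. The vanishing
  truncated difference expresses \<open>z < triangle (Suc s)\<close>, so the search returns the sum
  of the coordinates of \<open>z\<close>.\<close>

definition diag_index :: "nat \<Rightarrow> nat" where
  "diag_index z = (LEAST s. Suc z - triangle (Suc s) = 0)"

lemma diag_index: "diag_index z = pfst z + psnd z"
proof -
  define x y where "x = pfst z" and "y = psnd z"
  have z: "z = triangle (x + y) + x"
    using prod_encode_pfst_psnd[of z] unfolding x_def y_def prod_encode_def by simp
  have "diag_index z = x + y"
    unfolding diag_index_def
  proof (rule Least_equality)
    show "Suc z - triangle (Suc (x + y)) = 0" using z by simp
  next
    fix s assume "Suc z - triangle (Suc s) = 0"
    then have "z < triangle (Suc s)" by simp
    show "x + y \<le> s"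
    proof (rule ccontr)
      assume "\<not> x + y \<le> s"
      then have "triangle (Suc s) \<le> triangle (x + y)" by (intro triangle_mono) simp
      then show False using \<open>z < triangle (Suc s)\<close> z by simp
    qed
  qed
  then show ?thesis by (simp add: x_def y_def)
qed

lemma computable_diag_index: "computable diag_index"
proof -
  obtain p where p: "evalr p [x] (triangle (Suc x))" for x
    using computable_triangle[OF computable_Suc[OF computable_id]] unfolding computable_def by blast
  obtain q where q: "evalr q [x, y] (y - x)" for x y
    using computable2_swapped_diff unfolding computable2_def by blast
  have "evalr (Cn q [Cn p [Id 0], Cn S [Id 1]]) [s, z] (Suc z - triangle (Suc s))" for s z
    by (rule evalr_Cn2[OF evalr_Cn1[OF evalr_Id0 p] evalr_Cn1[OF evalr_Id1 evS] q])
  then have c: "computable2 (\<lambda>s z. Suc z - triangle (Suc s))"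
    unfolding computable2_def by blast
  have "Suc z - triangle (Suc z) = 0" for z by simp
  then have "computable (\<lambda>z. LEAST s. Suc z - triangle (Suc s) = 0)"
    by (intro computable_Least[OF c]) blast
  then show ?thesis unfolding diag_index_def[abs_def] .
qed

lemma computable_pfst0: "computable pfst"
proof -
  have "pfst z = z - triangle (diag_index z)" for z
    using prod_encode_pfst_psnd[of z] unfolding diag_index prod_encode_def by simp
  then have "pfst = (\<lambda>z. z - triangle (diag_index z))" by auto
  then show ?thesis
    using computable_diff[OF computable_id computable_triangle[OF computable_diag_index]] by metis
qed

lemma computable_psnd0: "computable psnd"
proof -
  have "psnd = (\<lambda>z. diag_index z - pfst z)" by (auto simp: diag_index)
  then show ?thesis
    using computable_diff[OF computable_diag_index computable_pfst0] by metis
qed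

lemmas computable_pfst = computable_comp[OF computable_pfst0]
lemmas computable_psnd = computable_comp[OF computable_psnd0]

text \<open>The ternary step function is presented as a unary function of a nested pair, so that
  later computability proofs concern unary functions only and follow the syntax of the term. As
  \<open>Pr\<close> passes its arguments separately, a binary pairing program is put in
  between.\<close>

lemma computable_rec_nat:
  assumes "computable h" "computable f"
    and "computable (\<lambda>z. g (pfst z) (pfst (psnd z)) (psnd (psnd z)))"
  shows "computable (\<lambda>x. rec_nat (f x) (\<lambda>n y. g n y x) (h x))"
proof -
  obtain r where r: "evalr r [z] (g (pfst z) (pfst (psnd z)) (psnd (psnd z)))" for z
    using assms(3) unfolding computable_def by blast
  have "computable2 (\<lambda>x y. prod_encode (x, y))"
  proof -
    obtain a where a: "evalr a [x, y] (x + y)" for x y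
      using computable2_add unfolding computable2_def by blast
    obtain t where t: "evalr t [x] (triangle x)" for x
      using computable_triangle0 unfolding computable_def by blast
    have "evalr (Cn a [Cn t [a], Id 0]) [x, y] (prod_encode (x, y))" for x y
      unfolding prod_encode_def by (auto intro: evalr_Cn2[OF evalr_Cn1[OF a t] evalr_Id0 a])
    then show ?thesis unfolding computable2_def by blast
  qed
  then obtain p where p: "evalr p [x, y] (prod_encode (x, y))" for x y
    unfolding computable2_def by blast
  have s: "evalr (Cn r [Cn p [Id 0, Cn p [Id 1, Id 2]]]) [n, y, x] (g n y x)" for n y x
    using evalr_Cn1[OF evalr_Cn2[OF evalr_Id0 evalr_Cn2[OF evalr_Id1 evalr_Id2 p] p] r, of n y x "[]"]
    by simp
  have "computable2 (\<lambda>n x. rec_nat (f x) (\<lambda>n y. g n y x) n)"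
    by (rule computable2_Pr[OF assms(2) s])
  from computable2_comp[OF this assms(1) computable_id] show ?thesis .
qed

section \<open>Decidable predicates, Boolean connectives and bounded quantifiers\<close>

definition decidable :: "(nat \<Rightarrow> bool) \<Rightarrow> bool" where
  "decidable P \<longleftrightarrow> computable (\<lambda>x. if P x then 1 else 0)"

lemma computable_if:
  assumes "decidable P" "computable f" "computable g"
  shows "computable (\<lambda>x. if P x then f x else g x)"
proof -
  have "computable (\<lambda>x. (if P x then 1 else 0) * f x + (1 - (if P x then 1 else 0)) * g x)"
    using assms unfolding decidable_def
    by (intro computable_add computable_mult computable_diff computable_const)
  moreover have "(\<lambda>x. (if P x then 1 else 0) * f x + (1 - (if P x then 1 else 0)) * g x)
      = (\<lambda>x. if P x then f x else g x)"
    by auto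
  ultimately show ?thesis by simp
qed

lemma decidable_eq0: "computable f \<Longrightarrow> decidable (\<lambda>x. f x = 0)"
proof -
  assume "computable f"
  then have "computable (\<lambda>x. 1 - f x)"
    by (intro computable_diff computable_const)
  moreover have "(\<lambda>x. 1 - f x) = (\<lambda>x. if f x = 0 then 1 else 0)" by auto
  ultimately show ?thesis unfolding decidable_def by simp
qed

lemma decidable_const: "decidable (\<lambda>_. b)"
  unfolding decidable_def by (rule computable_const)

text \<open>The Boolean connectives below are all instances of this conditional.\<close>

lemma decidable_if:
  assumes "decidable P" "decidable Q" "decidable R"
  shows "decidable (\<lambda>x. if P x then Q x else R x)"
proof -
  have "computable (\<lambda>x. if P x then (if Q x then 1 else 0) else (if R x then 1 else 0))"
    using assms(2,3) unfolding decidable_def by (rule computable_if[OF assms(1)])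
  moreover have "(\<lambda>x. if P x then (if Q x then 1 else 0) else (if R x then 1 else 0))
      = (\<lambda>x. if if P x then Q x else R x then 1 else (0::nat))"
    by auto
  ultimately show ?thesis unfolding decidable_def by simp
qed

lemma decidable_cong: "decidable P \<Longrightarrow> (\<And>x. P x \<longleftrightarrow> Q x) \<Longrightarrow> decidable Q"
  by (simp add: ext[of P Q])

lemma decidable_not: "decidable P \<Longrightarrow> decidable (\<lambda>x. \<not> P x)"
  by (rule decidable_cong[OF decidable_if[of P "\<lambda>_. False" "\<lambda>_. True"]]) (auto intro: decidable_const)

lemma decidable_conj: "decidable P \<Longrightarrow> decidable Q \<Longrightarrow> decidable (\<lambda>x. P x \<and> Q x)"
  by (rule decidable_cong[OF decidable_if[of P Q "\<lambda>_. False"]]) (auto intro: decidable_const)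

lemma decidable_disj: "decidable P \<Longrightarrow> decidable Q \<Longrightarrow> decidable (\<lambda>x. P x \<or> Q x)"
  by (rule decidable_cong[OF decidable_if[of P "\<lambda>_. True" Q]]) (auto intro: decidable_const)

lemma decidable_imp: "decidable P \<Longrightarrow> decidable Q \<Longrightarrow> decidable (\<lambda>x. P x \<longrightarrow> Q x)"
  by (rule decidable_cong[OF decidable_if[of P Q "\<lambda>_. True"]]) (auto intro: decidable_const)

lemma decidable_iff: "decidable P \<Longrightarrow> decidable Q \<Longrightarrow> decidable (\<lambda>x. P x \<longleftrightarrow> Q x)"
  by (rule decidable_cong[OF decidable_if[of P Q "\<lambda>x. \<not> Q x"]]) (auto intro: decidable_not)

lemma decidable_eq: "computable f \<Longrightarrow> computable g \<Longrightarrow> decidable (\<lambda>x. f x = g x)"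
proof -
  assume "computable f" "computable g"
  then have "decidable (\<lambda>x. (f x - g x) + (g x - f x) = 0)"
    by (intro decidable_eq0 computable_add computable_diff)
  moreover have "(\<lambda>x. (f x - g x) + (g x - f x) = 0) = (\<lambda>x. f x = g x)" by auto
  ultimately show ?thesis by simp
qed

lemma decidable_bex:
  assumes "computable g" "decidable (\<lambda>z. P (pfst z) (psnd z))"
  shows "decidable (\<lambda>x. \<exists>y<g x. P y x)"
proof -
  \<comment> \<open>The recursion step sees counter, accumulator and parameter, so the predicate is
    first rewritten to skip the accumulator.\<close>
  have "decidable (\<lambda>z. P (pfst z) (psnd (psnd z)))"
    using computable_comp[OF assms(2)[unfolded decidable_def],
        of "\<lambda>z. prod_encode (pfst z, psnd (psnd z))"]
    unfolding decidable_def
    by (simp add: computable_prod_encode computable_pfst computable_psnd computable_id)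
  then have "computable (\<lambda>x. rec_nat 0 (\<lambda>n y. if P n x then 1 else y) (g x))"
    by (intro computable_rec_nat assms(1) computable_const computable_if
        computable_pfst computable_psnd computable_id)
  moreover have eq: "rec_nat 0 (\<lambda>n y. if P n x then 1 else y) m = (if \<exists>y<m. P y x then 1 else 0)" for m x
    by (induction m) (auto simp: less_Suc_eq)
  ultimately show ?thesis unfolding decidable_def by (simp only: eq)
qed

lemma decidable_ball:
  assumes "computable g" "decidable (\<lambda>z. P (pfst z) (psnd z))"
  shows "decidable (\<lambda>x. \<forall>y<g x. P y x)"
  using decidable_not[OF decidable_bex[OF assms(1) decidable_not[OF assms(2)]]] by simp

lemma computable_fact0: "computable fact"
proof -
  have "rec_nat 1 (\<lambda>n y. y * Suc n) n = fact n" for n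
    by (induction n) auto
  moreover have "computable (\<lambda>n. rec_nat 1 (\<lambda>n y. y * Suc n) n)"
    by (intro computable_rec_nat computable_id computable_const computable_mult computable_Suc
        computable_pfst computable_psnd)
  ultimately show ?thesis by simp
qed

lemmas computable_fact = computable_comp[OF computable_fact0]

section \<open>Encoded lists\<close>

text \<open>The code of a nonempty list is the successor of a pair code, hence the predecessor; the
  empty list has code \<open>0\<close>.\<close>

definition lhd :: "nat \<Rightarrow> nat" where "lhd L = pfst (L - 1)"
definition ltl :: "nat \<Rightarrow> nat" where "ltl L = psnd (L - 1)"
definition lcons :: "nat \<Rightarrow> nat \<Rightarrow> nat" where "lcons x L = Suc (prod_encode (x, L))"
definition ldrop :: "nat \<Rightarrow> nat \<Rightarrow> nat" where "ldrop n L = rec_nat L (\<lambda>_ y. ltl y) n"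
definition lnth :: "nat \<Rightarrow> nat \<Rightarrow> nat" where "lnth n L = lhd (ldrop n L)"
text \<open>The condition \<open>ldrop i L \<noteq> 0\<close> says that \<open>i\<close> is a valid
  index. The bound \<open>L\<close> loses nothing, because no list is longer than its code.\<close>

definition lmem :: "nat \<Rightarrow> nat \<Rightarrow> bool" where
  "lmem y L \<longleftrightarrow> (\<exists>i<L. ldrop i L \<noteq> 0 \<and> lnth i L = y)"

lemma lhd_Cons [simp]: "lhd (list_encode (x # xs)) = x"
  by (simp add: lhd_def)

lemma ltl_encode [simp]: "ltl (list_encode xs) = list_encode (tl xs)"
proof -
  have "psnd 0 = 0" using psnd_prod_encode[of 0 0] by (simp add: prod_encode_def)
  then show ?thesis by (cases xs) (auto simp: ltl_def)
qed

lemma lcons_encode [simp]: "lcons x (list_encode xs) = list_encode (x # xs)"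
  by (simp add: lcons_def)

lemma list_encode_eq_0_iff [simp]: "list_encode xs = 0 \<longleftrightarrow> xs = []"
  by (cases xs) auto

lemma ldrop_encode [simp]: "ldrop n (list_encode xs) = list_encode (drop n xs)"
  by (induction n) (auto simp: ldrop_def drop_Suc drop_tl)

lemma lnth_encode [simp]: "n < length xs \<Longrightarrow> lnth n (list_encode xs) = xs ! n"
  by (simp add: lnth_def Cons_nth_drop_Suc[symmetric] del: list_encode.simps)

lemma length_le_list_encode: "length xs \<le> list_encode xs"
  by (induction xs) (auto intro: order_trans[OF _ le_prod_encode_2])

lemma lmem_encode [simp]: "lmem y (list_encode xs) \<longleftrightarrow> y \<in> set xs"
proof
  assume "y \<in> set xs"
  then obtain i where "i < length xs" "xs ! i = y" by (auto simp: in_set_conv_nth)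
  then show "lmem y (list_encode xs)"
    unfolding lmem_def using length_le_list_encode[of xs] by (intro exI[of _ i]) auto
qed (auto simp: lmem_def)

lemma lmem_0 [simp]: "\<not> lmem y 0"
  by (simp add: lmem_def)

lemma lmem_lcons [simp]: "lmem y (lcons x L) \<longleftrightarrow> y = x \<or> lmem y L"
  by (metis lcons_encode list_decode_inverse lmem_encode set_ConsD list.set_intros)

text \<open>Entries lie below the code of their list. This is why the quantifiers of
  \<open>derivable\<close> can be bounded by the list of premises, and hence why derivability is
  decidable.\<close>

lemma lmem_less: "lmem y L \<Longrightarrow> y < L"
proof -
  have "y \<in> set xs \<Longrightarrow> y < list_encode xs" for xs
    by (induction xs)
      (auto simp: less_Suc_eq_le intro: le_prod_encode_1 order_trans[OF less_imp_le le_prod_encode_2])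
  then show "lmem y L \<Longrightarrow> y < L"
    by (metis list_decode_inverse lmem_encode)
qed

lemma computable_lhd: "computable f \<Longrightarrow> computable (\<lambda>x. lhd (f x))"
  unfolding lhd_def by (intro computable_pfst computable_diff computable_const)

lemma computable_ltl: "computable f \<Longrightarrow> computable (\<lambda>x. ltl (f x))"
  unfolding ltl_def by (intro computable_psnd computable_diff computable_const)

lemma computable_lcons: "computable f \<Longrightarrow> computable g \<Longrightarrow> computable (\<lambda>x. lcons (f x) (g x))"
  unfolding lcons_def by (intro computable_Suc computable_prod_encode)

lemma computable_ldrop: "computable f \<Longrightarrow> computable g \<Longrightarrow> computable (\<lambda>x. ldrop (f x) (g x))"
  unfolding ldrop_def
  by (intro computable_rec_nat computable_ltl computable_pfst computable_psnd computable_id)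

lemma computable_lnth: "computable f \<Longrightarrow> computable g \<Longrightarrow> computable (\<lambda>x. lnth (f x) (g x))"
  unfolding lnth_def by (intro computable_lhd computable_ldrop)

lemma decidable_lmem:
  assumes "computable f" "computable g"
  shows "decidable (\<lambda>x. lmem (f x) (g x))"
  unfolding lmem_def
  by (intro decidable_bex decidable_conj decidable_not decidable_eq computable_lnth computable_ldrop
      computable_pfst computable_const computable_id computable_psnd assms
      computable_comp[OF assms(1)] computable_comp[OF assms(2)])

lemmas computability_intros =
  computable_id computable_const computable_Suc computable_add computable_diff computable_mult
  computable_prod_encode computable_pfst computable_psnd computable_rec_nat computable_if
  computable_fact computable_lhd computable_ltl computable_lcons computable_ldrop computable_lnth
  decidable_const decidable_not decidable_conj decidable_disj decidable_imp decidable_iff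
  decidable_eq decidable_bex decidable_ball decidable_lmem

section \<open>An undecidable recursively enumerable set\<close>

fun recf_code :: "recf \<Rightarrow> nat" where
  "recf_code Z = prod_encode (0, 0)"
| "recf_code S = prod_encode (1, 0)"
| "recf_code (Id i) = prod_encode (2, i)"
| "recf_code (Cn f gs) = prod_encode (3, prod_encode (recf_code f, list_encode (map recf_code gs)))"
| "recf_code (Pr f g) = prod_encode (4, prod_encode (recf_code f, recf_code g))"
| "recf_code (Mn f) = prod_encode (5, recf_code f)"

text \<open>Encodes the claim that the program with code \<open>c\<close> returns \<open>y\<close>
  on the input list with code \<open>U\<close>.\<close>

definition judgement :: "nat \<Rightarrow> nat \<Rightarrow> nat \<Rightarrow> nat" where
  "judgement c U y = prod_encode (c, prod_encode (U, y))"

text \<open>\<open>T\<close> and \<open>A\<close> are the tag and the argument of the program code, \<open>U\<close> is the encoded input, and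
  \<open>L\<close> lists the judgements available as premises.\<close>
definition derivable :: "nat \<Rightarrow> nat \<Rightarrow> nat \<Rightarrow> nat \<Rightarrow> nat \<Rightarrow> bool" where
  "derivable T A U y L \<longleftrightarrow>
     T = 0 \<and> y = 0 \<or>
     T = 1 \<and> U \<noteq> 0 \<and> y = Suc (lhd U) \<or>
     T = 2 \<and> ldrop A U \<noteq> 0 \<and> y = lnth A U \<or>
     T = 3 \<and> (\<exists>Y<L. lmem (judgement (pfst A) Y y) L \<and>
       (\<forall>i<Suc (psnd A + Y). (ldrop i (psnd A) = 0 \<longleftrightarrow> ldrop i Y = 0) \<and>
          (ldrop i Y \<noteq> 0 \<longrightarrow> lmem (judgement (lnth i (psnd A)) U (lnth i Y)) L))) \<or>
     T = 4 \<and> U \<noteq> 0 \<and> (lhd U = 0 \<and> lmem (judgement (pfst A) (ltl U) y) L \<or>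
       lhd U \<noteq> 0 \<and> (\<exists>v<L.
         lmem (judgement (prod_encode (4, A)) (lcons (lhd U - 1) (ltl U)) v) L \<and>
         lmem (judgement (psnd A) (lcons (lhd U - 1) (lcons v (ltl U))) y) L)) \<or>
     T = 5 \<and> lmem (judgement A (lcons y U) 0) L \<and>
       (\<forall>m<y. \<exists>v<L. v \<noteq> 0 \<and> lmem (judgement A (lcons m U) v) L)"

text \<open>Stage \<open>t\<close> tries to add the judgement \<open>pfst t\<close>; every judgement is tried at arbitrarily late stages.\<close>
definition stage :: "nat \<Rightarrow> nat" where
  "stage = rec_nat 0 (\<lambda>t L.
     if derivable (pfst (pfst (pfst t))) (psnd (pfst (pfst t))) (pfst (psnd (pfst t))) (psnd (psnd (pfst t))) L
     then lcons (pfst t) L else L)"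

section \<open>Soundness and completeness of the enumeration by stages\<close>

lemma judgement_less:
  assumes "lmem (judgement c U y) L"
  shows "U < L" "y < L"
proof -
  have "U \<le> judgement c U y" "y \<le> judgement c U y"
    unfolding judgement_def
    by (meson le_prod_encode_1 le_prod_encode_2 order_trans)+
  then show "U < L" "y < L" using lmem_less[OF assms] by auto
qed

text \<open>The code of \<open>r\<close> fixes the tag, so only one clause of
  \<open>derivable\<close> can apply, and that clause mirrors the \<open>evalr\<close> rules for the
  outermost constructor of \<open>r\<close>.\<close>

lemma derivable_sound:
  assumes L: "\<And>r xs y. lmem (judgement (recf_code r) (list_encode xs) y) L \<Longrightarrow> evalr r xs y"
    and d: "derivable (pfst (recf_code r)) (psnd (recf_code r)) (list_encode xs) y L"
  shows "evalr r xs y"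
proof (cases r)
  case Z
  then show ?thesis using d by (auto simp: derivable_def intro: evZ)
next
  case S
  then show ?thesis using d by (cases xs) (auto simp: derivable_def simp del: list_encode.simps intro: evS)
next
  case (Id i)
  then show ?thesis using d by (auto simp: derivable_def intro: evId)
next
  case (Cn f gs)
  let ?gs = "map recf_code gs"
  obtain Y where Y: "lmem (judgement (recf_code f) Y y) L"
    and i: "\<And>i. i < Suc (list_encode ?gs + Y) \<Longrightarrow>
      (ldrop i (list_encode ?gs) = 0 \<longleftrightarrow> ldrop i Y = 0) \<and>
      (ldrop i Y \<noteq> 0 \<longrightarrow> lmem (judgement (lnth i (list_encode ?gs)) (list_encode xs) (lnth i Y)) L)"
    using d unfolding Cn by (auto simp: derivable_def)
  \<comment> \<open>Every number is the code of a list, so the witness \<open>Y\<close> can be read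
    as the list of intermediate values.\<close>
  define ys where "ys = list_decode Y"
  have Ye: "Y = list_encode ys" by (simp add: ys_def)
  have le: "length gs \<le> list_encode ?gs" "length ys \<le> list_encode ys"
    using length_le_list_encode[of ?gs] length_le_list_encode[of ys] by auto
  have drops: "length gs \<le> i \<longleftrightarrow> length ys \<le> i" if "i < Suc (list_encode ?gs + list_encode ys)" for i
    using i[of i] that unfolding Ye ldrop_encode by simp
  \<comment> \<open>The index range in the clause for \<open>Cn\<close> contains both lengths;
    comparing the emptiness of the two tails at these indices forces the lengths to agree.\<close>
  have len: "length gs = length ys"
    using drops[of "length gs"] drops[of "length ys"] le by simp
  have "evalr (gs ! i) xs (ys ! i)" if "i < length gs" for i
    using i[of i] that le len L unfolding Ye by simp
  then have "list_all2 (\<lambda>g y. evalr g xs y) gs ys"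
    using len by (simp add: list_all2_conv_all_nth)
  moreover have "evalr f ys y" using Y L unfolding Ye by blast
  ultimately show ?thesis unfolding Cn by (rule evCn)
next
  case (Pr f g)
  let ?c = "prod_encode (4, prod_encode (recf_code f, recf_code g))"
  have "xs \<noteq> []" using d Pr by (auto simp: derivable_def)
  then obtain n xs' where xs: "xs = n # xs'" by (cases xs) auto
  show ?thesis
  proof (cases n)
    case 0
    then have "lmem (judgement (recf_code f) (list_encode xs') y) L"
      using d Pr xs by (auto simp: derivable_def simp del: list_encode.simps)
    then show ?thesis using L Pr xs 0 by (auto intro: evPr0)
  next
    case (Suc k)
    then obtain v where "lmem (judgement ?c (list_encode (k # xs')) v) L"
      "lmem (judgement (recf_code g) (list_encode (k # v # xs')) y) L"
      using d Pr xs by (auto simp: derivable_def simp del: list_encode.simps)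
    then have "evalr (Pr f g) (k # xs') v" "evalr g (k # v # xs') y"
      using L[of "Pr f g" "k # xs'" v] L[of g "k # v # xs'" y] by auto
    then show ?thesis using Pr xs Suc by (auto intro: evPrS)
  qed
next
  case (Mn f)
  have "lmem (judgement (recf_code f) (list_encode (y # xs)) 0) L"
    and "\<forall>m<y. \<exists>v<L. v \<noteq> 0 \<and> lmem (judgement (recf_code f) (list_encode (m # xs)) v) L"
    using d Mn by (auto simp: derivable_def simp del: list_encode.simps)
  then show ?thesis unfolding Mn using L by (intro evMn) blast+
qed

lemma stage_Suc:
  "stage (Suc t) = (if derivable (pfst (pfst (pfst t))) (psnd (pfst (pfst t)))
      (pfst (psnd (pfst t))) (psnd (psnd (pfst t))) (stage t)
     then lcons (pfst t) (stage t) else stage t)"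
  by (simp add: stage_def)

lemma stage_sound: "lmem (judgement (recf_code r) (list_encode xs) y) (stage t) \<Longrightarrow> evalr r xs y"
proof (induction t arbitrary: r xs y)
  case 0
  then show ?case by (simp add: stage_def)
next
  case (Suc t)
  show ?case
  proof (cases "lmem (judgement (recf_code r) (list_encode xs) y) (stage t)")
    case True
    then show ?thesis by (rule Suc.IH)
  next
    case False
    then have "pfst t = judgement (recf_code r) (list_encode xs) y"
      "derivable (pfst (pfst (pfst t))) (psnd (pfst (pfst t)))
        (pfst (psnd (pfst t))) (psnd (psnd (pfst t))) (stage t)"
      using Suc.prems by (auto simp: stage_Suc split: if_splits)
    then have "derivable (pfst (recf_code r)) (psnd (recf_code r)) (list_encode xs) y (stage t)"
      by (simp add: judgement_def)
    then show ?thesis using Suc.IH derivable_sound by blast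
  qed
qed

lemma lmem_stage_mono: "s \<le> t \<Longrightarrow> lmem z (stage s) \<Longrightarrow> lmem z (stage t)"
  by (induction t rule: dec_induct) (auto simp: stage_Suc)

lemma derivable_imp_stage:
  assumes "\<And>t. t \<ge> s \<Longrightarrow> derivable (pfst c) (psnd c) U y (stage t)"
  shows "\<exists>t. lmem (judgement c U y) (stage t)"
proof -
  \<comment> \<open>A stage that tries the wanted judgement; the second component \<open>s\<close>
    makes its number at least \<open>s\<close>.\<close>
  let ?t = "prod_encode (judgement c U y, s)"
  have "derivable (pfst c) (psnd c) U y (stage ?t)"
    by (rule assms) (rule le_prod_encode_2)
  then have "stage (Suc ?t) = lcons (judgement c U y) (stage ?t)"
    by (subst stage_Suc) (simp add: judgement_def)
  then have "lmem (judgement c U y) (stage (Suc ?t))" by simp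
  then show ?thesis ..
qed

text \<open>Stages only grow, so the latest of finitely many stages serves for all. Needed for the
  unboundedly many premises of \<open>evCn\<close> and \<open>evMn\<close>.\<close>

lemma stage_finite_union:
  assumes "\<And>i. i < (n::nat) \<Longrightarrow> \<exists>t. lmem (f i) (stage t)"
  shows "\<exists>t. \<forall>i<n. lmem (f i) (stage t)"
  using assms
proof (induction n)
  case (Suc n)
  then obtain t where t: "\<forall>i<n. lmem (f i) (stage t)" by auto
  obtain s where s: "lmem (f n) (stage s)" using Suc.prems by blast
  have "lmem (f i) (stage (max s t))" if "i < Suc n" for i
    using that s t by (cases "i = n") (auto intro: lmem_stage_mono[of s] lmem_stage_mono[of t])
  then show ?case by blast
qed simp

text \<open>By induction on the evaluation, the premises occur in some stage and therefore in all
  later ones. The conclusion is then derivable from every late stage and is added at one of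
  them.\<close>

lemma stage_complete: "evalr r xs y \<Longrightarrow> \<exists>t. lmem (judgement (recf_code r) (list_encode xs) y) (stage t)"
proof (induction rule: evalr.induct)
  case (evZ xs)
  show ?case by (rule derivable_imp_stage) (simp add: derivable_def)
next
  case (evS x xs)
  show ?case by (rule derivable_imp_stage) (simp add: derivable_def del: list_encode.simps)
next
  case (evId i xs)
  then show ?case by (intro derivable_imp_stage) (simp add: derivable_def)
next
  case (evCn xs gs ys f z)
  obtain s1 where s1: "lmem (judgement (recf_code f) (list_encode ys) z) (stage s1)"
    using evCn.IH by blast
  have len: "length gs = length ys" using evCn(1) by (rule list_all2_lengthD)
  have "\<exists>t. \<forall>i<length gs. lmem (judgement (recf_code (gs ! i)) (list_encode xs) (ys ! i)) (stage t)"
    using evCn(1) by (intro stage_finite_union) (auto simp: list_all2_conv_all_nth)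
  then obtain s2 where s2: "\<And>i. i < length gs \<Longrightarrow>
      lmem (judgement (recf_code (gs ! i)) (list_encode xs) (ys ! i)) (stage s2)"
    by blast
  show ?case
  proof (rule derivable_imp_stage[of "max s1 s2"])
    fix t assume t: "max s1 s2 \<le> t"
    have 1: "lmem (judgement (recf_code f) (list_encode ys) z) (stage t)"
      using lmem_stage_mono[OF _ s1] t by simp
    have 2: "lmem (judgement (recf_code (gs ! i)) (list_encode xs) (ys ! i)) (stage t)"
      if "i < length gs" for i
      using lmem_stage_mono[OF _ s2[OF that]] t by simp
    have "lmem (judgement (lnth i (list_encode (map recf_code gs))) (list_encode xs)
        (lnth i (list_encode ys))) (stage t)" if "drop i ys \<noteq> []" for i
      using that 2[of i] len by simp
    then show "derivable (pfst (recf_code (Cn f gs))) (psnd (recf_code (Cn f gs))) (list_encode xs) z (stage t)"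
      using 1 judgement_less(1)[OF 1] len
      by (auto simp: derivable_def intro!: exI[of _ "list_encode ys"] simp flip: neq0_conv)
  qed
next
  case (evPr0 f xs y g)
  then obtain s where s: "lmem (judgement (recf_code f) (list_encode xs) y) (stage s)" by blast
  show ?case
    by (rule derivable_imp_stage[of s])
      (auto simp: derivable_def lmem_stage_mono[OF _ s] simp del: list_encode.simps)
next
  case (evPrS f g n xs y z)
  then obtain s1 s2 where s: "lmem (judgement (recf_code (Pr f g)) (list_encode (n # xs)) y) (stage s1)"
    "lmem (judgement (recf_code g) (list_encode (n # y # xs)) z) (stage s2)" by blast
  show ?case
  proof (rule derivable_imp_stage[of "max s1 s2"])
    fix t assume t: "max s1 s2 \<le> t"
    have 1: "lmem (judgement (recf_code (Pr f g)) (list_encode (n # xs)) y) (stage t)"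
      "lmem (judgement (recf_code g) (list_encode (n # y # xs)) z) (stage t)"
      using lmem_stage_mono[OF _ s(1)] lmem_stage_mono[OF _ s(2)] t by auto
    show "derivable (pfst (recf_code (Pr f g))) (psnd (recf_code (Pr f g)))
        (list_encode (Suc n # xs)) z (stage t)"
      using 1 judgement_less(2)[OF 1(1)]
      by (auto simp: derivable_def simp del: list_encode.simps)
  qed
next
  case (evMn f n xs)
  then obtain s1 where s1: "lmem (judgement (recf_code f) (list_encode (n # xs)) 0) (stage s1)" by blast
  have "\<forall>m<n. \<exists>y. y \<noteq> 0 \<and> (\<exists>t. lmem (judgement (recf_code f) (list_encode (m # xs)) y) (stage t))"
    using evMn.IH(2) by blast
  then obtain v where v: "\<And>m. m < n \<Longrightarrow> v m \<noteq> 0"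
    "\<And>m. m < n \<Longrightarrow> \<exists>t. lmem (judgement (recf_code f) (list_encode (m # xs)) (v m)) (stage t)"
    by metis
  obtain s2 where s2: "\<And>m. m < n \<Longrightarrow> lmem (judgement (recf_code f) (list_encode (m # xs)) (v m)) (stage s2)"
    using stage_finite_union[of n "\<lambda>m. judgement (recf_code f) (list_encode (m # xs)) (v m)"] v(2)
    by blast
  show ?case
  proof (rule derivable_imp_stage[of "max s1 s2"])
    fix t assume t: "max s1 s2 \<le> t"
    have 1: "lmem (judgement (recf_code f) (list_encode (n # xs)) 0) (stage t)"
      using lmem_stage_mono[OF _ s1] t by simp
    have 2: "lmem (judgement (recf_code f) (list_encode (m # xs)) (v m)) (stage t)" if "m < n" for m
      using lmem_stage_mono[OF _ s2[OF that]] t by simp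
    have "\<exists>w<stage t. w \<noteq> 0 \<and> lmem (judgement (recf_code f) (list_encode (m # xs)) w) (stage t)"
      if "m < n" for m
      using 2[OF that] v(1)[OF that] judgement_less(2) by blast
    then show "derivable (pfst (recf_code (Mn f))) (psnd (recf_code (Mn f))) (list_encode xs) n (stage t)"
      using 1 by (auto simp: derivable_def simp del: list_encode.simps)
  qed
qed

lemma decidable_derivable:
  assumes "computable f1" "computable f2" "computable f3" "computable f4" "computable f5"
  shows "decidable (\<lambda>x. derivable (f1 x) (f2 x) (f3 x) (f4 x) (f5 x))"
  unfolding derivable_def judgement_def
  \<comment> \<open>The rules \<open>assms[THEN computable_comp]\<close> serve the occurrences under
    bounded quantifiers, where the parameter has to be projected out of a pair.\<close>
  by (intro computability_intros assms assms[THEN computable_comp])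

lemma computable_stage: "computable f \<Longrightarrow> computable (\<lambda>x. stage (f x))"
  unfolding stage_def by (intro computability_intros decidable_derivable)

text \<open>\<open>\<not> running k t\<close> means that program \<open>k\<close> on input \<open>k\<close> has been seen to return \<open>0\<close> by stage \<open>t\<close>.\<close>
definition running :: "nat \<Rightarrow> nat \<Rightarrow> bool" where
  "running k t \<longleftrightarrow> \<not> lmem (judgement k (lcons k 0) 0) (stage t)"

lemma running_antimono: "running k t \<Longrightarrow> s \<le> t \<Longrightarrow> running k s"
  unfolding running_def using lmem_stage_mono by blast

lemma decidable_running: "computable f \<Longrightarrow> computable g \<Longrightarrow> decidable (\<lambda>x. running (f x) (g x))"
  unfolding running_def judgement_def by (intro computability_intros computable_stage)

text \<open>Diagonalisation: a program that returns \<open>0\<close> exactly on those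
  \<open>k\<close> which \<open>d\<close> declares to run forever contradicts \<open>d\<close> on
  its own code.\<close>

lemma not_computable_running_forever:
  assumes "computable d" and d: "\<And>k. d k = 1 \<longleftrightarrow> (\<forall>t. running k t)"
  shows False
proof -
  have "computable (\<lambda>k. if d k = 1 then 0 else 1)"
    by (intro computability_intros assms(1))
  then obtain r where r: "\<And>k. evalr r [k] (if d k = 1 then 0 else 1)"
    unfolding computable_def by blast
  define k where "k = recf_code r"
  have run: "running k t \<longleftrightarrow> \<not> lmem (judgement (recf_code r) (list_encode [k]) 0) (stage t)" for t
    unfolding running_def k_def lcons_def by simp
  show False
  proof (cases "d k = 1")
    case True
    then show ?thesis using r[of k] d[of k] stage_complete[of r "[k]" 0] run by auto
  next
    case False
    then have "evalr r [k] 0" using d[of k] stage_sound run by blast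
    from evalr_deterministic[OF this r[of k]] show ?thesis using False by simp
  qed
qed

section \<open>Evaluation of words\<close>

lemma (in group) letter_val_closed:
  assumes "set s \<subseteq> carrier G" "k \<noteq> 0" "\<bar>k\<bar> \<le> int (length s)"
  shows "letter_val G s k \<in> carrier G"
proof -
  have "s ! nat (k - 1) \<in> carrier G" if "k > 0"
    using that assms by (intro subsetD[OF assms(1)] nth_mem) linarith
  moreover have "s ! nat (- k - 1) \<in> carrier G" if "\<not> k > 0"
    using that assms by (intro subsetD[OF assms(1)] nth_mem) linarith
  ultimately show ?thesis by (auto simp: letter_val_def)
qed

lemma word_val_Nil [simp]: "word_val G s [] = \<one>\<^bsub>G\<^esub>"
  by (simp add: word_val_def)

lemma word_val_Cons [simp]: "word_val G s (k # w) = letter_val G s k \<otimes>\<^bsub>G\<^esub> word_val G s w"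
  by (simp add: word_val_def)

lemma valid_word_Nil [simp]: "valid_word n []"
  by (simp add: valid_word_def)

lemma valid_word_Cons [simp]: "valid_word n (k # w) \<longleftrightarrow> k \<noteq> 0 \<and> \<bar>k\<bar> \<le> int n \<and> valid_word n w"
  by (auto simp: valid_word_def)

lemma valid_word_append [simp]: "valid_word n (u @ v) \<longleftrightarrow> valid_word n u \<and> valid_word n v"
  by (auto simp: valid_word_def)

lemma valid_word_replicate: "k \<noteq> 0 \<Longrightarrow> \<bar>k\<bar> \<le> int n \<Longrightarrow> valid_word n (replicate x k)"
  by (auto simp: valid_word_def)

lemma (in group) word_val_closed:
  "set s \<subseteq> carrier G \<Longrightarrow> valid_word (length s) w \<Longrightarrow> word_val G s w \<in> carrier G"
  by (induction w) (auto simp: letter_val_closed)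

lemma (in group) word_val_append:
  assumes "set s \<subseteq> carrier G" "valid_word (length s) u" "valid_word (length s) v"
  shows "word_val G s (u @ v) = word_val G s u \<otimes> word_val G s v"
  using assms(2) by (induction u) (auto simp: assms m_assoc letter_val_closed word_val_closed)

definition inverse_word :: "int list \<Rightarrow> int list" where
  "inverse_word w = rev (map uminus w)"

lemma valid_inverse_word [simp]: "valid_word n (inverse_word w) \<longleftrightarrow> valid_word n w"
  by (auto simp: valid_word_def inverse_word_def)

lemma (in group) letter_val_uminus:
  assumes "set s \<subseteq> carrier G" "k \<noteq> 0" "\<bar>k\<bar> \<le> int (length s)"
  shows "letter_val G s (- k) = inv (letter_val G s k)"
proof (cases "k > 0")
  case True
  then show ?thesis by (simp add: letter_val_def)
next
  case False
  have "s ! nat (- k - 1) \<in> carrier G"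
    using False assms by (intro subsetD[OF assms(1)] nth_mem) linarith
  then show ?thesis using False assms(2) by (simp add: letter_val_def)
qed

lemma (in group) word_val_inverse:
  assumes "set s \<subseteq> carrier G" "valid_word (length s) w"
  shows "word_val G s (inverse_word w) = inv (word_val G s w)"
  using assms(2)
proof (induction w)
  case (Cons k w)
  have "word_val G s (inverse_word (k # w)) = word_val G s (inverse_word w @ [- k])"
    by (simp add: inverse_word_def)
  also have "\<dots> = word_val G s (inverse_word w) \<otimes> word_val G s [- k]"
    using Cons.prems by (intro word_val_append assms(1)) auto
  also have "\<dots> = inv (word_val G s (k # w))"
    using Cons assms(1) by (simp add: letter_val_uminus letter_val_closed word_val_closed inv_mult_group)
  finally show ?case .
qed (simp add: inverse_word_def)

lemma (in group) word_val_replicate: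
  assumes "letter_val G s k \<in> carrier G"
  shows "word_val G s (replicate x k) = letter_val G s k [^] x"
proof (induction x)
  case (Suc x)
  then show ?case using assms nat_pow_Suc2[OF assms, of x] by simp
qed simp

lemma (in group) word_val_in_generate:
  assumes "set s \<subseteq> carrier G" "valid_word (length s) w"
  shows "word_val G s w \<in> generate G (set s)"
  using assms(2)
proof (induction w)
  case Nil
  then show ?case by (simp add: generate.one)
next
  case (Cons k w)
  have "letter_val G s k \<in> generate G (set s)"
  proof (cases "k > 0")
    case True
    then have "s ! nat (k - 1) \<in> set s" using Cons.prems by (intro nth_mem) auto
    then show ?thesis using True by (simp add: letter_val_def generate.incl)
  next
    case False
    then have "s ! nat (- k - 1) \<in> set s" using Cons.prems by (intro nth_mem) auto
    then show ?thesis using False by (simp add: letter_val_def generate.inv)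
  qed
  then show ?case using Cons by (auto intro: generate.eng)
qed

lemma word_val_hom:
  assumes "group G" "group H" "h \<in> hom G H" "set s \<subseteq> carrier G" "valid_word (length s) w"
  shows "h (word_val G s w) = word_val H (map h s) w"
proof -
  interpret group_hom G H h using assms by (simp add: group_hom_def group_hom_axioms_def)
  have l: "h (letter_val G s k) = letter_val H (map h s) k" if "k \<noteq> 0" "\<bar>k\<bar> \<le> int (length s)" for k
  proof (cases "k > 0")
    case True
    then show ?thesis using that by (auto simp: letter_val_def nth_map)
  next
    case False
    then have "nat (- k - 1) < length s" using that by linarith
    then have "s ! nat (- k - 1) \<in> carrier G" using assms(4) nth_mem by blast
    then show ?thesis using False \<open>nat (- k - 1) < length s\<close> by (simp add: letter_val_def)
  qed
  show ?thesis
    using assms(5)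
    by (induction w) (auto simp: l G.letter_val_closed[OF assms(4)] G.word_val_closed[OF assms(4)])
qed

section \<open>The largest residually finite group satisfying given relators\<close>

definition word_decode :: "nat \<Rightarrow> int list" where
  "word_decode c = map int_decode (list_decode c)"

lemma word_decode_code [simp]: "word_decode (word_code w) = w"
  by (simp add: word_decode_def word_code_def comp_def)

locale relators =
  fixes n :: nat and R :: "int list set"
  assumes relators_valid: "w \<in> R \<Longrightarrow> valid_word n w"
begin

text \<open>Quantifying over all finite groups requires a fixed carrier type; \<open>nat\<close>
  contains a copy of each, as exploited in \<open>not_equiv_wordsI\<close>.\<close>

definition model :: "nat monoid \<Rightarrow> nat list \<Rightarrow> bool" where
  "model F fs \<longleftrightarrow> group F \<and> finite (carrier F) \<and> length fs = n \<and> set fs \<subseteq> carrier F \<and>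
     (\<forall>w\<in>R. word_val F fs w = \<one>\<^bsub>F\<^esub>)"

definition equiv_words :: "int list \<Rightarrow> int list \<Rightarrow> bool" where
  "equiv_words u v \<longleftrightarrow> (\<forall>F fs. model F fs \<longrightarrow> word_val F fs u = word_val F fs v)"

text \<open>The least code of an equivalent valid word is a canonical name for the class, which
  makes the quotient a group on natural numbers.\<close>

definition rep :: "int list \<Rightarrow> nat" where
  "rep w = (LEAST c. \<exists>u. valid_word n u \<and> equiv_words u w \<and> c = word_code u)"

definition quot :: "nat monoid" where
  "quot = \<lparr>partial_object.carrier = rep ` {w. valid_word n w},
     monoid.mult = (\<lambda>x y. rep (word_decode x @ word_decode y)), monoid.one = rep []\<rparr>"

definition gens :: "nat list" where
  "gens = map (\<lambda>i. rep [int i + 1]) [0..<n]"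

section \<open>Group structure and generators of the quotient\<close>

lemma rep_decode:
  assumes "valid_word n w"
  shows "valid_word n (word_decode (rep w))" "equiv_words (word_decode (rep w)) w"
proof -
  have "\<exists>c u. valid_word n u \<and> equiv_words u w \<and> c = word_code u"
    using assms by (auto simp: equiv_words_def)
  from LeastI_ex[OF this] obtain u where "valid_word n u" "equiv_words u w" "rep w = word_code u"
    unfolding rep_def by blast
  then show "valid_word n (word_decode (rep w))" "equiv_words (word_decode (rep w)) w" by auto
qed

lemma rep_eq_iff:
  assumes "valid_word n u" "valid_word n v"
  shows "rep u = rep v \<longleftrightarrow> equiv_words u v"
proof
  assume "rep u = rep v"
  then show "equiv_words u v"
    using rep_decode(2)[OF assms(1)] rep_decode(2)[OF assms(2)] by (simp add: equiv_words_def)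
next
  assume "equiv_words u v"
  then have "equiv_words w u \<longleftrightarrow> equiv_words w v" for w by (auto simp: equiv_words_def)
  then show "rep u = rep v" by (simp add: rep_def)
qed

lemma model_word_val_append:
  "model F fs \<Longrightarrow> valid_word n u \<Longrightarrow> valid_word n v \<Longrightarrow>
    word_val F fs (u @ v) = word_val F fs u \<otimes>\<^bsub>F\<^esub> word_val F fs v"
  unfolding model_def using group.word_val_append by blast

lemma equiv_words_append:
  assumes "equiv_words u u'" "equiv_words v v'"
    "valid_word n u" "valid_word n u'" "valid_word n v" "valid_word n v'"
  shows "equiv_words (u @ v) (u' @ v')"
  using assms by (auto simp: equiv_words_def model_word_val_append)

lemma mult_rep:
  assumes "valid_word n u" "valid_word n v"
  shows "rep u \<otimes>\<^bsub>quot\<^esub> rep v = rep (u @ v)"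
  using assms rep_decode[OF assms(1)] rep_decode[OF assms(2)]
  by (simp add: quot_def rep_eq_iff equiv_words_append)

lemma one_quot: "\<one>\<^bsub>quot\<^esub> = rep []"
  by (simp add: quot_def)

lemma carrier_quot: "carrier quot = rep ` {w. valid_word n w}"
  by (simp add: quot_def)

lemma rep_inverse:
  assumes "valid_word n w"
  shows "rep (inverse_word w @ w) = rep []"
proof -
  have "equiv_words (inverse_word w @ w) []"
    using assms
    by (auto simp: equiv_words_def model_word_val_append)
      (auto simp: model_def group.word_val_inverse group.word_val_closed group.l_inv)
  then show ?thesis using assms by (simp add: rep_eq_iff)
qed

lemma group_quot: "group quot"
proof (rule groupI)
  fix x assume "x \<in> carrier quot"
  then obtain w where w: "valid_word n w" "x = rep w" by (auto simp: carrier_quot)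
  then have "rep (inverse_word w) \<in> carrier quot \<and> rep (inverse_word w) \<otimes>\<^bsub>quot\<^esub> x = \<one>\<^bsub>quot\<^esub>"
    using rep_inverse by (auto simp: carrier_quot one_quot mult_rep)
  then show "\<exists>y\<in>carrier quot. y \<otimes>\<^bsub>quot\<^esub> x = \<one>\<^bsub>quot\<^esub>" by blast
qed (auto simp: carrier_quot one_quot mult_rep)

lemma set_gens: "set gens \<subseteq> carrier quot"
  by (auto simp: gens_def carrier_quot)

lemma length_gens [simp]: "length gens = n"
  by (simp add: gens_def)

lemma letter_val_quot:
  assumes "k \<noteq> 0" "\<bar>k\<bar> \<le> int n"
  shows "letter_val quot gens k = rep [k]"
proof (cases "k > 0")
  case True
  then show ?thesis using assms by (simp add: letter_val_def gens_def nat_less_iff)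
next
  case False
  then have "gens ! nat (- k - 1) = rep [- k]"
    using assms by (simp add: gens_def nat_less_iff)
  moreover have "inv\<^bsub>quot\<^esub> (rep [- k]) = rep [k]"
  proof (rule group.inv_equality[OF group_quot])
    show "rep [k] \<otimes>\<^bsub>quot\<^esub> rep [- k] = \<one>\<^bsub>quot\<^esub>"
      using assms rep_inverse[of "[- k]"] by (simp add: mult_rep one_quot inverse_word_def)
  qed (use assms in \<open>auto simp: carrier_quot\<close>)
  ultimately show ?thesis using False by (simp add: letter_val_def)
qed

lemma word_val_quot: "valid_word n w \<Longrightarrow> word_val quot gens w = rep w"
  by (induction w) (auto simp: one_quot letter_val_quot mult_rep)

lemma word_val_quot_eq_one_iff:
  "valid_word n w \<Longrightarrow> word_val quot gens w = \<one>\<^bsub>quot\<^esub> \<longleftrightarrow> equiv_words w []"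
  by (simp add: word_val_quot one_quot rep_eq_iff)

lemma generate_gens: "generate quot (set gens) = carrier quot"
proof
  show "generate quot (set gens) \<subseteq> carrier quot"
    by (rule group.generate_incl[OF group_quot set_gens])
  show "carrier quot \<subseteq> generate quot (set gens)"
    using group.word_val_in_generate[OF group_quot set_gens] word_val_quot
    by (auto simp: carrier_quot)
qed

text \<open>The universal property: equivalent words agree in every model by definition, so
  evaluation in a model factors through the quotient.\<close>

lemma model_hom:
  assumes "model F fs"
  shows "(\<lambda>x. word_val F fs (word_decode x)) \<in> hom quot F"
    and "\<And>w. valid_word n w \<Longrightarrow> word_val F fs (word_decode (rep w)) = word_val F fs w"
proof -
  show eq: "word_val F fs (word_decode (rep w)) = word_val F fs w" if "valid_word n w" for w
    using rep_decode(2)[OF that] assms by (simp add: equiv_words_def)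
  have "word_val F fs w \<in> carrier F" if "valid_word n w" for w
    using assms that group.word_val_closed unfolding model_def by blast
  then show "(\<lambda>x. word_val F fs (word_decode x)) \<in> hom quot F"
    by (intro homI) (auto simp: carrier_quot mult_rep eq model_word_val_append[OF assms])
qed

text \<open>A nontrivial class is detected by some model. The kernel of evaluation there has finite
  index, since the quotient by it embeds in the finite model.\<close>

lemma residually_finite_quot: "residually_finite quot"
  unfolding residually_finite_def
proof (intro ballI impI)
  fix x assume "x \<in> carrier quot" "x \<noteq> \<one>\<^bsub>quot\<^esub>"
  then obtain w where w: "valid_word n w" "x = rep w" "rep w \<noteq> rep []"
    by (auto simp: carrier_quot one_quot)
  then obtain F fs where F: "model F fs" "word_val F fs w \<noteq> \<one>\<^bsub>F\<^esub>"
    by (auto simp: rep_eq_iff equiv_words_def)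
  define h where "h = (\<lambda>x. word_val F fs (word_decode x))"
  interpret group_hom quot F h
    using F(1) model_hom(1) group_quot
    by (auto simp: group_hom_def group_hom_axioms_def h_def model_def)
  have "finite ((\<lambda>C. the_elem (h ` C)) ` carrier (quot Mod kernel quot F h))"
  proof (rule finite_subset)
    show "(\<lambda>C. the_elem (h ` C)) ` carrier (quot Mod kernel quot F h) \<subseteq> carrier F"
      using FactGroup_the_elem_mem by blast
  qed (use F(1) in \<open>simp add: model_def\<close>)
  then have "finite (carrier (quot Mod kernel quot F h))"
    by (rule finite_imageD[OF _ FactGroup_inj_on])
  then have "finite (rcosets\<^bsub>quot\<^esub> (kernel quot F h))" by (simp add: FactGroup_def)
  moreover have "x \<notin> kernel quot F h"
    using w F model_hom(2)[OF F(1)] by (simp add: kernel_def h_def)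
  ultimately show "\<exists>N. N \<lhd> quot \<and> finite (rcosets\<^bsub>quot\<^esub> N) \<and> x \<notin> N"
    using normal_kernel by blast
qed

text \<open>Relators are trivial in \<open>quot\<close> and homomorphisms commute with evaluation,
  which gives one direction. Conversely, a finite group satisfying the relators is a model and
  evaluation is the required homomorphism. CFQ is thereby reduced to checking relators.\<close>

lemma extends_hom_iff:
  assumes "group F" "finite (carrier F)" "length fs = n" "set fs \<subseteq> carrier F"
  shows "extends_hom quot gens F fs \<longleftrightarrow> (\<forall>w\<in>R. word_val F fs w = \<one>\<^bsub>F\<^esub>)"
proof
  assume "extends_hom quot gens F fs"
  then obtain h where h: "h \<in> hom quot F" "\<forall>i<n. h (gens ! i) = fs ! i"
    by (auto simp: extends_hom_def)
  have fs: "map h gens = fs" using h(2) assms(3) by (intro nth_equalityI) simp_all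
  show "\<forall>w\<in>R. word_val F fs w = \<one>\<^bsub>F\<^esub>"
  proof
    fix w assume "w \<in> R"
    then have "equiv_words w []" by (simp add: equiv_words_def model_def)
    then have "word_val quot gens w = \<one>\<^bsub>quot\<^esub>"
      using word_val_quot_eq_one_iff relators_valid[OF \<open>w \<in> R\<close>] by blast
    then show "word_val F fs w = \<one>\<^bsub>F\<^esub>"
      using word_val_hom[OF group_quot assms(1) h(1) set_gens, of w] relators_valid[OF \<open>w \<in> R\<close>]
        hom_one[OF h(1) group_quot assms(1)] fs by simp
  qed
next
  assume "\<forall>w\<in>R. word_val F fs w = \<one>\<^bsub>F\<^esub>"
  then have m: "model F fs" using assms by (simp add: model_def)
  have "word_val F fs (word_decode (gens ! i)) = fs ! i" if "i < n" for i
  proof -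
    have "fs ! i \<in> carrier F" using that assms(3,4) nth_mem by blast
    then show ?thesis
      using that model_hom(2)[OF m, of "[int i + 1]"] assms(1)
      by (simp add: gens_def letter_val_def group.is_monoid monoid.r_one)
  qed
  then show "extends_hom quot gens F fs"
    unfolding extends_hom_def length_gens
    by (intro bexI[OF _ model_hom(1)[OF m]]) blast
qed

text \<open>Allows separating groups of any carrier type: an injection of the finite carrier into
  \<open>nat\<close> transports \<open>H\<close> to a model.\<close>

lemma not_equiv_wordsI:
  fixes H (structure)
  assumes "group H" "finite (carrier H)" "length fs = n" "set fs \<subseteq> carrier H"
    and R: "\<And>w. w \<in> R \<Longrightarrow> word_val H fs w = \<one>"
    and ne: "word_val H fs u \<noteq> word_val H fs v"
    and valid: "valid_word n u" "valid_word n v"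
  shows "\<not> equiv_words u v"
proof
  assume eq: "equiv_words u v"
  obtain f :: "'a \<Rightarrow> nat" where f: "inj_on f (carrier H)"
    using finite_imp_inj_to_nat_seg[OF assms(2)] by blast
  let ?F = "image_group f H"
  have hom: "f \<in> hom H ?F"
    using f by (intro homI) (auto simp: image_group_def)
  then have "f \<in> iso H ?F"
    using f by (auto simp: iso_def bij_betw_def image_group_carrier)
  from group.iso_imp_img_group[OF assms(1) this] have F: "group ?F"
    by (simp add: image_group_def)
  have val: "f (word_val H fs w) = word_val ?F (map f fs) w" if "valid_word n w" for w
    using word_val_hom[OF assms(1) F hom assms(4)] that assms(3) by simp
  have "model ?F (map f fs)"
    unfolding model_def
  proof (intro conjI ballI)
    fix w assume w: "w \<in> R"
    show "word_val ?F (map f fs) w = \<one>\<^bsub>?F\<^esub>"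
      using val[OF relators_valid[OF w]] R[OF w] by (simp add: image_group_one)
  qed (use F assms(2-4) in \<open>auto simp: image_group_carrier\<close>)
  then have "f (word_val H fs u) = f (word_val H fs v)"
    using eq val valid by (simp add: equiv_words_def)
  then have "word_val H fs u = word_val H fs v"
    using inj_onD[OF f] group.word_val_closed[OF assms(1,4)] valid assms(3) by blast
  with ne show False ..
qed

end

section \<open>The relators\<close>

text \<open>The letters \<open>1\<close>, \<open>2\<close>, \<open>3\<close> stand for the
  generators \<open>a\<close>, \<open>b\<close>, \<open>c\<close>.\<close>

definition conj_word :: "nat \<Rightarrow> int list" where
  "conj_word x = replicate x 1 @ [2] @ replicate x (- 1)"

definition relator :: "nat \<Rightarrow> int list" where
  "relator x = conj_word x @ [3] @ inverse_word (conj_word x) @ [- 3]"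

lemma valid_conj_word: "valid_word 3 (conj_word x)"
  by (simp add: conj_word_def valid_word_replicate)

lemma valid_relator: "valid_word 3 (relator x)"
  by (simp add: relator_def valid_conj_word)

lemma (in group) commutator_eq_one_iff:
  assumes "q \<in> carrier G" "c \<in> carrier G"
  shows "q \<otimes> (c \<otimes> (inv q \<otimes> inv c)) = \<one> \<longleftrightarrow> q \<otimes> c = c \<otimes> q"
proof -
  have "q \<otimes> (c \<otimes> (inv q \<otimes> inv c)) = (q \<otimes> c) \<otimes> inv (c \<otimes> q)"
    using assms by (simp add: inv_mult_group m_assoc)
  then show ?thesis
    using assms by (metis inv_closed inv_equality inv_inv m_closed r_inv)
qed

text \<open>The commutator is trivial exactly when its entries commute. In this form the condition
  visibly depends on \<open>x\<close> only through \<open>a [^] x\<close>.\<close>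

lemma (in group) word_val_relator_eq_one_iff:
  assumes "a \<in> carrier G" "b \<in> carrier G" "c \<in> carrier G"
  shows "word_val G [a, b, c] (relator x) = \<one> \<longleftrightarrow>
    (a [^] x \<otimes> b \<otimes> inv (a [^] x)) \<otimes> c = c \<otimes> (a [^] x \<otimes> b \<otimes> inv (a [^] x))"
proof -
  let ?s = "[a, b, c]"
  have s: "set ?s \<subseteq> carrier G" using assms by simp
  have valid: "valid_word (length ?s) (conj_word x)"
    using valid_conj_word by (simp add: numeral_3_eq_3)
  have letters: "letter_val G ?s 1 = a" "letter_val G ?s (- 1) = inv a" "letter_val G ?s 2 = b"
    "letter_val G ?s 3 = c" "letter_val G ?s (- 3) = inv c"
    by (simp_all add: letter_val_def numeral_2_eq_2)
  have "word_val G ?s (conj_word x) = a [^] x \<otimes> (b \<otimes> inv a [^] x)"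
    unfolding conj_word_def using assms
    by (simp add: word_val_append[OF s] valid_word_replicate word_val_replicate letters)
  then have q: "word_val G ?s (conj_word x) = a [^] x \<otimes> b \<otimes> inv (a [^] x)"
    using assms by (simp add: m_assoc nat_pow_inv)
  have "word_val G ?s (relator x) = word_val G ?s (conj_word x) \<otimes>
      (c \<otimes> (inv (word_val G ?s (conj_word x)) \<otimes> inv c))"
    unfolding relator_def using assms valid
    by (simp add: word_val_append[OF s] word_val_inverse[OF s] letters)
  then show ?thesis
    unfolding q using assms by (simp add: commutator_eq_one_iff)
qed

text \<open>The exponents of stage \<open>t\<close> tend profinitely to \<open>fact (Suc k)\<close> as \<open>t\<close> grows, and these
  tend to \<open>0\<close> as \<open>k\<close> grows; so a group of order \<open>m\<close> only sees the exponents with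
  \<open>k < m\<close> and \<open>t \<le> m\<close>.\<close>
definition exponent :: "nat \<Rightarrow> nat \<Rightarrow> nat" where
  "exponent k t = fact (Suc k) + fact (k + 2 + t)"

text \<open>In a finite group the exponent \<open>0\<close> accounts for all
  \<open>exponent k t\<close> with \<open>k\<close> at least the group order, so the behaviour of
  those programs need not be examined.\<close>

definition exponents :: "nat set" where
  "exponents = insert 0 {exponent k t | k t. running k t}"

interpretation relators 3 "relator ` exponents"
  by unfold_locales (auto simp: valid_relator)

section \<open>Reduction to finitely many exponents in a finite group\<close>

lemma (in group) pow_fact_eq_one:
  assumes "a \<in> carrier G" "finite (carrier G)" "order G \<le> n"
  shows "a [^] (fact n :: nat) = \<one>"
proof -
  have "order G > 0" using assms(2) by (simp add: order_gt_0_iff_finite)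
  then have "order G dvd fact n" using assms(3) by (intro dvd_fact) auto
  then obtain q where "fact n = order G * q" ..
  then show ?thesis
    using assms(1) by (metis nat_pow_one nat_pow_pow pow_order_eq_1)
qed

lemma (in group) pow_exponent:
  assumes "a \<in> carrier G" "finite (carrier G)"
  shows "order G \<le> t \<Longrightarrow> a [^] exponent k t = a [^] (fact (Suc k) :: nat)"
    and "order G \<le> k \<Longrightarrow> a [^] exponent k t = \<one>"
  using assms pow_fact_eq_one[OF assms, of "k + 2 + t"] pow_fact_eq_one[OF assms, of "Suc k"]
  by (simp_all add: exponent_def nat_pow_mult[symmetric] del: fact_Suc)

text \<open>From \<open>t = order G\<close> on, the power is independent of \<open>t\<close>, and a
  program running at a later stage was already running at stage \<open>order G\<close>. That single
  stage represents all later ones, whence the bound \<open>Suc (order G)\<close>. For large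
  \<open>k\<close> the power is the identity.\<close>

lemma (in group) all_exponents_iff:
  assumes "a \<in> carrier G" "finite (carrier G)"
  shows "(\<forall>x\<in>exponents. Q (a [^] x)) \<longleftrightarrow>
    Q \<one> \<and> (\<forall>k < order G. \<forall>t<Suc (order G). running k t \<longrightarrow> Q (a [^] exponent k t))"
proof
  assume *: "\<forall>x\<in>exponents. Q (a [^] x)"
  then have "Q (a [^] (0::nat))" unfolding exponents_def by blast
  with * show "Q \<one> \<and> (\<forall>k < order G. \<forall>t<Suc (order G). running k t \<longrightarrow> Q (a [^] exponent k t))"
    unfolding exponents_def by auto
next
  assume *: "Q \<one> \<and> (\<forall>k < order G. \<forall>t<Suc (order G). running k t \<longrightarrow> Q (a [^] exponent k t))"
  have "Q (a [^] exponent k t)" if "running k t" for k t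
  proof (cases "k < order G")
    case True
    show ?thesis
    proof (cases "t < order G")
      case False
      then have "running k (order G)" using running_antimono[OF that] by simp
      then have "Q (a [^] exponent k (order G))" using * True by simp
      then show ?thesis using False pow_exponent(1)[OF assms] by simp
    qed (use * True that in simp)
  qed (use * pow_exponent(2)[OF assms] in simp)
  then show "\<forall>x\<in>exponents. Q (a [^] x)" using * by (auto simp: exponents_def)
qed

text \<open>In a model of order \<open>m\<close> the relator for \<open>exponent k m\<close> holds,
  and there \<open>a\<close> has the same power for this exponent as for
  \<open>fact (Suc k)\<close>.\<close>

lemma running_forever_imp_trivial:
  assumes "\<And>t. running k t"
  shows "equiv_words (relator (fact (Suc k))) []"
  unfolding equiv_words_def
proof (intro allI impI)
  fix F fs assume m: "model F fs"
  interpret group F using m by (simp add: model_def)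
  have "length fs = 3" using m by (simp add: model_def)
  then obtain a b c where fs: "fs = [a, b, c]"
    by (auto simp: length_Suc_conv numeral_3_eq_3)
  have abc: "a \<in> carrier F" "b \<in> carrier F" "c \<in> carrier F" and fin: "finite (carrier F)"
    using m by (auto simp: model_def fs)
  have "exponent k (order F) \<in> exponents" using assms by (auto simp: exponents_def)
  then have "word_val F [a, b, c] (relator (exponent k (order F))) = \<one>\<^bsub>F\<^esub>"
    using m by (auto simp: model_def fs)
  then show "word_val F fs (relator (fact (Suc k))) = word_val F fs []"
    unfolding fs word_val_relator_eq_one_iff[OF abc] pow_exponent(1)[OF abc(1) fin order_refl]
    using word_val_relator_eq_one_iff[OF abc, of "fact (Suc k)"] by simp
qed

section \<open>Separating permutation groups\<close>

definition perm_group :: "'a set \<Rightarrow> ('a \<Rightarrow> 'a) monoid" where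
  "perm_group A = \<lparr>partial_object.carrier = {p. p permutes A}, monoid.mult = (\<circ>), monoid.one = id\<rparr>"

lemma group_perm_group: "group (perm_group A)"
proof (rule groupI)
  fix p assume "p \<in> carrier (perm_group A)"
  then have "p permutes A" by (simp add: perm_group_def)
  then show "\<exists>q\<in>carrier (perm_group A). q \<otimes>\<^bsub>perm_group A\<^esub> p = \<one>\<^bsub>perm_group A\<^esub>"
    by (intro bexI[of _ "inv_into UNIV p"])
      (auto simp: perm_group_def permutes_inv permutes_inv_o)
qed (auto simp: perm_group_def permutes_compose permutes_id comp_assoc)

definition cyc :: "nat \<Rightarrow> nat \<Rightarrow> nat" where
  "cyc n i = (if i < n then Suc i mod n else i)"

lemma cyc_permutes: "cyc n permutes {..<n}"
proof (rule bij_imp_permutes)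
  have "inj_on (cyc n) {..<n}"
    by (auto simp: inj_on_def cyc_def mod_Suc split: if_splits)
  moreover have "cyc n ` {..<n} \<subseteq> {..<n}" by (auto simp: cyc_def)
  ultimately show "bij_betw (cyc n) {..<n} {..<n}"
    using endo_inj_surj[of "{..<n}" "cyc n"] by (simp add: bij_betw_def)
qed (auto simp: cyc_def)

lemma comp_transpose: "inj p \<Longrightarrow> p \<circ> transpose i j = transpose (p i) (p j) \<circ> p"
  by (auto simp: fun_eq_iff transpose_def inj_eq)

text \<open>The transpositions are disjoint exactly when \<open>i\<close> and \<open>j\<close>
  differ; if \<open>i = j\<close>, the two products disagree at the point
  \<open>Suc n\<close>.\<close>

lemma transpose_commute_iff:
  assumes "i \<noteq> n" "i \<noteq> Suc n" "j \<noteq> n" "j \<noteq> Suc n"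
  shows "transpose i n \<circ> transpose j (Suc n) = transpose j (Suc n) \<circ> transpose i n \<longleftrightarrow> i \<noteq> j"
proof
  assume "transpose i n \<circ> transpose j (Suc n) = transpose j (Suc n) \<circ> transpose i n"
  then have "(transpose i n \<circ> transpose j (Suc n)) (Suc n) = (transpose j (Suc n) \<circ> transpose i n) (Suc n)"
    by simp
  then show "i \<noteq> j" using assms by (auto simp: transpose_def)
next
  assume "i \<noteq> j"
  then show "transpose i n \<circ> transpose j (Suc n) = transpose j (Suc n) \<circ> transpose i n"
    using assms by (auto simp: fun_eq_iff transpose_def)
qed

text \<open>Conjugation by the power of the cycle turns \<open>transpose 0 n\<close> into
  \<open>transpose (x mod n) n\<close>, because that power sends \<open>0\<close> to
  \<open>x mod n\<close> and fixes \<open>n\<close>. The result fails to commute with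
  \<open>transpose u (Suc n)\<close> only if both move the same point below
  \<open>n\<close>.\<close>

lemma word_val_perm_group:
  assumes "u < n"
  shows "word_val (perm_group {..<Suc (Suc n)}) [cyc n, transpose 0 n, transpose u (Suc n)] (relator x)
      = \<one>\<^bsub>perm_group {..<Suc (Suc n)}\<^esub> \<longleftrightarrow> x mod n \<noteq> u"
proof -
  let ?H = "perm_group {..<Suc (Suc n)}"
  interpret group ?H by (rule group_perm_group)
  have mult: "p \<otimes>\<^bsub>?H\<^esub> q = p \<circ> q" for p q by (simp add: perm_group_def)
  have a: "cyc n \<in> carrier ?H"
    using permutes_subset[OF cyc_permutes] by (auto simp: perm_group_def)
  have b: "transpose i j \<in> carrier ?H" if "i < Suc (Suc n)" "j < Suc (Suc n)" for i j
    using that by (simp add: perm_group_def permutes_swap_id)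
  let ?p = "cyc n [^]\<^bsub>?H\<^esub> x"
  have p: "?p \<in> carrier ?H" using a by (rule nat_pow_closed)
  have val: "(cyc n [^]\<^bsub>?H\<^esub> y) 0 = y mod n" "(cyc n [^]\<^bsub>?H\<^esub> y) n = n" for y :: nat
  proof (induction y)
    case 0
    show "(cyc n [^]\<^bsub>?H\<^esub> (0::nat)) 0 = 0 mod n" "(cyc n [^]\<^bsub>?H\<^esub> (0::nat)) n = n"
      by (simp_all add: perm_group_def)
  next
    case (Suc y)
    have "cyc n [^]\<^bsub>?H\<^esub> Suc y = cyc n \<circ> cyc n [^]\<^bsub>?H\<^esub> y"
      using nat_pow_Suc2[OF a, of y] unfolding mult .
    moreover have "cyc n (y mod n) = Suc y mod n" "cyc n n = n"
      using assms by (auto simp: cyc_def mod_Suc_eq)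
    ultimately show "(cyc n [^]\<^bsub>?H\<^esub> Suc y) 0 = Suc y mod n" "(cyc n [^]\<^bsub>?H\<^esub> Suc y) n = n"
      using Suc by (simp_all only: comp_apply)
  qed
  have "x mod n < n" using assms by simp
  then have "x mod n < Suc (Suc n)" by simp
  have "inj ?p" using p by (auto simp: perm_group_def intro: permutes_inj)
  then have "?p \<otimes>\<^bsub>?H\<^esub> transpose 0 n = transpose (x mod n) n \<otimes>\<^bsub>?H\<^esub> ?p"
    unfolding mult using comp_transpose[of ?p 0 n] val[of x] by simp
  then have q: "?p \<otimes>\<^bsub>?H\<^esub> transpose 0 n \<otimes>\<^bsub>?H\<^esub> inv\<^bsub>?H\<^esub> ?p = transpose (x mod n) n"
    using p b[OF \<open>x mod n < Suc (Suc n)\<close>, of n] by (simp add: m_assoc)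
  show ?thesis
    using word_val_relator_eq_one_iff[OF a b b, of 0 n u "Suc n" x] assms \<open>x mod n < n\<close>
      transpose_commute_iff[of "x mod n" n u]
    unfolding q unfolding mult by simp
qed

text \<open>If the larger factorial \<open>fact w\<close> vanishes modulo \<open>fact N\<close>, the
  smaller one must be \<open>fact (Suc k)\<close>. Otherwise the sum is below \<open>fact N\<close>,
  so it is not reduced, and it lies strictly between \<open>fact w\<close> and
  \<open>fact (Suc w)\<close>, hence is no factorial.\<close>

lemma exponent_mod_fact:
  assumes "exponent k' t mod fact N = (fact (Suc k) :: nat)" "Suc k < N"
  shows "k' = k \<and> N \<le> k + 2 + t"
proof -
  define v w where "v = Suc k'" and "w = k' + 2 + t"
  have vw: "v < w" "0 < v" by (auto simp: v_def w_def)
  have eq: "(fact v + fact w) mod fact N = (fact (Suc k) :: nat)"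
    using assms(1) by (simp only: exponent_def v_def w_def)
  show ?thesis
  proof (cases "N \<le> w")
    case True
    then have d: "fact N dvd (fact w :: nat)" by (rule fact_dvd)
    then have eq': "fact v mod fact N = (fact (Suc k) :: nat)"
      using eq by (metis add.right_neutral dvd_imp_mod_0 mod_add_right_eq)
    have "v < N"
    proof (rule ccontr)
      assume "\<not> v < N"
      then have "fact N dvd (fact v :: nat)" by (intro fact_dvd) simp
      then show False using eq' by (simp del: fact_Suc)
    qed
    then have "fact v < (fact N :: nat)" using vw by (intro fact_less_mono) auto
    then have "fact v = (fact (Suc k) :: nat)" using eq' by simp
    \<comment> \<open>Factorials are injective on positive numbers only, as
      \<open>fact 0 = fact 1\<close>; this is where \<open>0 < v\<close> enters.\<close>
    then have "v = Suc k"
      using fact_less_mono[of v "Suc k", where ?'a = nat] fact_less_mono[of "Suc k" v, where ?'a = nat] vw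
      by (cases v "Suc k" rule: linorder_cases) auto
    then show ?thesis using True by (simp add: v_def w_def)
  next
    case False
    have lt: "fact v < (fact w :: nat)" using vw by (intro fact_less_mono) auto
    have "2 * fact w \<le> (fact (Suc w) :: nat)" using vw by simp
    have "fact (Suc w) \<le> (fact N :: nat)" using False by (intro fact_mono) auto
    then have "fact v + fact w < (fact N :: nat)" using lt \<open>2 * fact w \<le> fact (Suc w)\<close> by linarith
    then have sum: "fact v + fact w = (fact (Suc k) :: nat)" using eq by simp
    then have "(fact w :: nat) < fact (Suc k)" using fact_gt_zero[of v, where ?'a = nat] by linarith
    then have "w < Suc k"
      using fact_mono[of "Suc k" w, where ?'a = nat] by (meson not_le)
    then have "fact (Suc w) \<le> (fact (Suc k) :: nat)" by (intro fact_mono) auto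
    then show ?thesis using sum lt \<open>2 * fact w \<le> fact (Suc w)\<close> by linarith
  qed
qed

lemma halted_imp_nontrivial:
  assumes "\<not> running k T"
  shows "\<not> equiv_words (relator (fact (Suc k))) []"
proof -
  \<comment> \<open>Chosen so that \<open>N \<le> k + 2 + t\<close> gives \<open>T < t\<close>: an
    exponent congruent to \<open>fact (Suc k)\<close> modulo \<open>fact N\<close> would need
    \<open>k\<close> to be running after stage \<open>T\<close>.\<close>
  define N where "N = k + 3 + T"
  let ?n = "fact N :: nat" and ?u = "fact (Suc k) :: nat"
  have u: "?u < ?n" by (rule fact_less_mono) (auto simp: N_def)
  let ?H = "perm_group {..<Suc (Suc ?n)}" and ?fs = "[cyc ?n, transpose 0 ?n, transpose ?u (Suc ?n)]"
  show ?thesis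
  proof (rule not_equiv_wordsI[of ?H ?fs])
    show "group ?H" by (rule group_perm_group)
    show "finite (carrier ?H)" by (simp add: perm_group_def finite_permutations)
    show "set ?fs \<subseteq> carrier ?H"
      using u permutes_subset[OF cyc_permutes, of ?n "{..<Suc (Suc ?n)}"]
      by (auto simp: perm_group_def permutes_swap_id simp del: fact_Suc)
    show "word_val ?H ?fs (relator ?u) \<noteq> word_val ?H ?fs []"
      using word_val_perm_group[OF u, of ?u] u by (simp del: fact_Suc)
    fix w assume "w \<in> relator ` exponents"
    then obtain x where x: "x \<in> exponents" "w = relator x" by blast
    have "x mod ?n \<noteq> ?u"
    proof
      assume eq: "x mod ?n = ?u"
      have "x \<noteq> 0" using eq fact_nonzero[of "Suc k", where ?'a = nat] by (metis mod_0)
      then obtain k' t where kt: "x = exponent k' t" "running k' t"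
        using x by (auto simp: exponents_def)
      then have "k' = k" "T < t" using exponent_mod_fact[of k' t N k] eq by (auto simp: N_def)
      then show False using kt(2) running_antimono[of k t T] assms by simp
    qed
    then show "word_val ?H ?fs w = \<one>\<^bsub>?H\<^esub>" using word_val_perm_group[OF u] x by simp
  qed (auto simp: valid_relator)
qed

text \<open>The relators are commutators, so they hold in the cyclic group of order 3, where the
  generators can be sent to three different elements.\<close>

lemma distinct_gens: "distinct gens"
proof -
  let ?H = "integer_mod_group 3"
  have ne: "\<not> equiv_words [int i + 1] [int j + 1]" if ij: "i < 3" "j < 3" "i \<noteq> j" for i j
  proof (rule not_equiv_wordsI[of ?H "[0, 1, 2]"])
    interpret comm_group ?H by (rule abelian_integer_mod_group)
    show "group ?H" by (rule group_integer_mod_group)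
    have carr: "carrier ?H = {0..<3}" by (simp add: carrier_integer_mod_group)
    show "finite (carrier ?H)" "set [0, 1, 2] \<subseteq> carrier ?H" by (auto simp: carr)
    have "word_val ?H [0, 1, 2] [int i + 1] = int i" if "i < 3" for i
    proof -
      have "[0, 1, 2] ! i = int i" using that by (auto simp: less_Suc_eq numeral_3_eq_3)
      then show ?thesis using that by (simp add: letter_val_def)
    qed
    then show "word_val ?H [0, 1, 2] [int i + 1] \<noteq> word_val ?H [0, 1, 2] [int j + 1]"
      using ij by simp
    show "word_val ?H [0, 1, 2] w = \<one>\<^bsub>?H\<^esub>" if "w \<in> relator ` exponents" for w
    proof -
      have "word_val ?H [0, 1, 2] (relator x) = \<one>\<^bsub>?H\<^esub>" for x
      proof (subst word_val_relator_eq_one_iff)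
        show "0 [^]\<^bsub>?H\<^esub> x \<otimes>\<^bsub>?H\<^esub> 1 \<otimes>\<^bsub>?H\<^esub> inv\<^bsub>?H\<^esub> (0 [^]\<^bsub>?H\<^esub> x) \<otimes>\<^bsub>?H\<^esub> 2
          = 2 \<otimes>\<^bsub>?H\<^esub> (0 [^]\<^bsub>?H\<^esub> x \<otimes>\<^bsub>?H\<^esub> 1 \<otimes>\<^bsub>?H\<^esub> inv\<^bsub>?H\<^esub> (0 [^]\<^bsub>?H\<^esub> x))"
          by (rule m_comm) (auto simp: carr)
      qed (auto simp: carr)
      then show ?thesis using that by auto
    qed
  qed (use ij in auto)
  have "i = j" if "i < 3" "j < 3" "rep [int i + 1] = rep [int j + 1]" for i j
    using that ne[of i j] by (auto simp: rep_eq_iff)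
  then show ?thesis by (auto simp: gens_def distinct_map inj_on_def)
qed

section \<open>The decision problems\<close>

definition lreplicate :: "nat \<Rightarrow> nat \<Rightarrow> nat \<Rightarrow> nat" where
  "lreplicate n c L = rec_nat L (\<lambda>_ y. lcons c y) n"

lemma lreplicate_encode: "lreplicate n c (list_encode L) = list_encode (replicate n c @ L)"
  by (induction n) (auto simp: lreplicate_def lcons_def)

lemma computable_lreplicate:
  "computable f \<Longrightarrow> computable g \<Longrightarrow> computable (\<lambda>x. lreplicate (f x) c (g x))"
  unfolding lreplicate_def by (intro computability_intros)

text \<open>Builds the code by numerical list operations from the right end of the word, which makes
  it computable in \<open>x\<close>.\<close>

lemma word_code_relator:
  "word_code (relator x) =
    lreplicate x (int_encode 1) (lcons (int_encode 2) (lreplicate x (int_encode (- 1))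
    (lcons (int_encode 3) (lreplicate x (int_encode 1) (lcons (int_encode (- 2))
    (lreplicate x (int_encode (- 1)) (lcons (int_encode (- 3)) (list_encode []))))))))"
  unfolding lcons_encode lreplicate_encode
  by (simp add: word_code_def relator_def conj_word_def inverse_word_def del: list_encode.simps)

lemma computable_word_code_relator:
  "computable f \<Longrightarrow> computable (\<lambda>x. word_code (relator (f x)))"
  unfolding word_code_relator by (intro computability_intros computable_lreplicate)

lemma not_solvable_WP_quot: "\<not> solvable_WP quot gens"
proof
  assume "solvable_WP quot gens"
  then obtain d where d: "computable d"
    "\<And>w. valid_word 3 w \<Longrightarrow> d (word_code w) = 1 \<longleftrightarrow> word_val quot gens w = \<one>\<^bsub>quot\<^esub>"
    by (auto simp: solvable_WP_def)
  have "computable (\<lambda>k. d (word_code (relator (fact (Suc k)))))"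
    by (intro computable_comp[OF d(1)] computable_word_code_relator computability_intros)
  moreover have "d (word_code (relator (fact (Suc k)))) = 1 \<longleftrightarrow> (\<forall>t. running k t)" for k
    using d(2)[OF valid_relator] word_val_quot_eq_one_iff[OF valid_relator]
      running_forever_imp_trivial halted_imp_nontrivial by blast
  ultimately show False by (rule not_computable_running_forever)
qed

section \<open>Checking the relators in a multiplication table\<close>

definition table_mult :: "nat \<Rightarrow> nat \<Rightarrow> nat \<Rightarrow> nat \<Rightarrow> nat" where
  "table_mult m T x y = lnth (x * m + y) T"

definition table_pow :: "nat \<Rightarrow> nat \<Rightarrow> nat \<Rightarrow> nat \<Rightarrow> nat \<Rightarrow> nat" where
  "table_pow m T e a x = rec_nat e (\<lambda>_ y. table_mult m T y a) x"

text \<open>The identity and the inverse are recognised as the idempotent \<open>e\<close> and as the solution \<open>q\<close>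
  of \<open>p q = e\<close>.\<close>
definition table_check :: "nat \<Rightarrow> nat \<Rightarrow> nat \<Rightarrow> nat \<Rightarrow> nat \<Rightarrow> bool" where
  "table_check m T a b c \<longleftrightarrow> (\<forall>e<m. table_mult m T e e = e \<longrightarrow>
     table_mult m T b c = table_mult m T c b \<and>
     (\<forall>k<m. \<forall>t<Suc m. running k t \<longrightarrow> (\<forall>q<m. table_mult m T (table_pow m T e a (exponent k t)) q = e \<longrightarrow>
        table_mult m T (table_mult m T (table_mult m T (table_pow m T e a (exponent k t)) b) q) c =
        table_mult m T c (table_mult m T (table_mult m T (table_pow m T e a (exponent k t)) b) q))))"

lemma computable_table_mult:
  "computable m \<Longrightarrow> computable T \<Longrightarrow> computable f \<Longrightarrow> computable g \<Longrightarrow>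
    computable (\<lambda>x. table_mult (m x) (T x) (f x) (g x))"
  unfolding table_mult_def by (intro computability_intros)

lemma computable_table_pow:
  assumes "computable m" "computable T" "computable e" "computable a" "computable f"
  shows "computable (\<lambda>x. table_pow (m x) (T x) (e x) (a x) (f x))"
  unfolding table_pow_def
  by (intro computability_intros computable_table_mult assms assms[THEN computable_comp])

lemma decidable_table_check:
  assumes "computable m" "computable T" "computable a" "computable b" "computable c"
  shows "decidable (\<lambda>x. table_check (m x) (T x) (a x) (b x) (c x))"
  unfolding table_check_def exponent_def
  by (intro computability_intros computable_table_mult computable_table_pow decidable_running
      assms assms[THEN computable_comp])

lemma table_check_correct:
  assumes "group (table_monoid m t)" "length t = m * m" "a < m" "b < m" "c < m"
  shows "table_check m (list_encode t) a b c \<longleftrightarrow>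
    (\<forall>w\<in>relator ` exponents. word_val (table_monoid m t) [a, b, c] w = \<one>\<^bsub>table_monoid m t\<^esub>)"
proof -
  let ?F = "table_monoid m t" and ?T = "list_encode t"
  interpret group ?F by (rule assms(1))
  have carr: "carrier ?F = {0..<m}" by (simp add: table_monoid_def)
  have fin: "finite (carrier ?F)" and ord: "order ?F = m" by (auto simp: carr order_def)
  have abc: "a \<in> carrier ?F" "b \<in> carrier ?F" "c \<in> carrier ?F" using assms by (auto simp: carr)
  have mult: "table_mult m ?T x y = x \<otimes>\<^bsub>?F\<^esub> y" if "x \<in> carrier ?F" "y \<in> carrier ?F" for x y
  proof -
    have "x * m + y < Suc x * m" using that by (simp add: carr)
    also have "\<dots> \<le> m * m" using that by (intro mult_le_mono1) (simp add: carr)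
    finally show ?thesis using assms(2) by (simp add: table_mult_def table_monoid_def)
  qed
  have pow: "table_pow m ?T \<one>\<^bsub>?F\<^esub> a x = a [^]\<^bsub>?F\<^esub> x" for x
    by (induction x) (auto simp: table_pow_def mult abc)
  have idem: "e \<in> carrier ?F \<Longrightarrow> table_mult m ?T e e = e \<longleftrightarrow> e = \<one>\<^bsub>?F\<^esub>" for e
    using mult[of e e] l_cancel_one'[of e e] by auto
  have all_e: "(\<forall>e<m. table_mult m ?T e e = e \<longrightarrow> P e) \<longleftrightarrow> P \<one>\<^bsub>?F\<^esub>" for P
    using idem one_closed unfolding carr by auto
  have all_q: "(\<forall>q<m. table_mult m ?T p q = \<one>\<^bsub>?F\<^esub> \<longrightarrow> P q) \<longleftrightarrow> P (inv\<^bsub>?F\<^esub> p)"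
    if "p \<in> carrier ?F" for p P
  proof -
    have eq: "q < m \<and> table_mult m ?T p q = \<one>\<^bsub>?F\<^esub> \<longleftrightarrow> q = inv\<^bsub>?F\<^esub> p" for q
    proof
      assume q: "q < m \<and> table_mult m ?T p q = \<one>\<^bsub>?F\<^esub>"
      then have "q \<in> carrier ?F" by (simp add: carr)
      then have "q \<otimes>\<^bsub>?F\<^esub> p = \<one>\<^bsub>?F\<^esub>" using q mult[OF that] inv_comm that by simp
      then show "q = inv\<^bsub>?F\<^esub> p" using \<open>q \<in> carrier ?F\<close> that inv_equality by simp
    next
      assume q: "q = inv\<^bsub>?F\<^esub> p"
      have "inv\<^bsub>?F\<^esub> p \<in> carrier ?F" using that by simp
      then show "q < m \<and> table_mult m ?T p q = \<one>\<^bsub>?F\<^esub>"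
        using mult[OF that] that unfolding q by (simp add: carr)
    qed
    have "(\<forall>q<m. table_mult m ?T p q = \<one>\<^bsub>?F\<^esub> \<longrightarrow> P q) \<longleftrightarrow>
        (\<forall>q. q < m \<and> table_mult m ?T p q = \<one>\<^bsub>?F\<^esub> \<longrightarrow> P q)"
      by (simp only: imp_conjL)
    then show ?thesis unfolding eq by simp
  qed
  define Q where "Q p \<longleftrightarrow> (p \<otimes>\<^bsub>?F\<^esub> b \<otimes>\<^bsub>?F\<^esub> inv\<^bsub>?F\<^esub> p) \<otimes>\<^bsub>?F\<^esub> c
      = c \<otimes>\<^bsub>?F\<^esub> (p \<otimes>\<^bsub>?F\<^esub> b \<otimes>\<^bsub>?F\<^esub> inv\<^bsub>?F\<^esub> p)" for p
  \<comment> \<open>The requirement in \<open>table_check\<close> that \<open>b\<close> and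
    \<open>c\<close> commute is \<open>Q\<close> at the identity, that is, the relator with exponent
    \<open>0\<close>.\<close>
  have "table_check m ?T a b c \<longleftrightarrow>
      Q \<one>\<^bsub>?F\<^esub> \<and> (\<forall>k<m. \<forall>t<Suc m. running k t \<longrightarrow> Q (a [^]\<^bsub>?F\<^esub> exponent k t))"
    unfolding table_check_def all_e pow
    by (simp add: all_q abc mult Q_def)
  also have "\<dots> \<longleftrightarrow> (\<forall>x\<in>exponents. Q (a [^]\<^bsub>?F\<^esub> x))"
    using all_exponents_iff[OF abc(1) fin, of Q] by (simp add: ord)
  also have "\<dots> \<longleftrightarrow> (\<forall>w\<in>relator ` exponents. word_val ?F [a, b, c] w = \<one>\<^bsub>?F\<^esub>)"
    by (simp add: word_val_relator_eq_one_iff[OF abc] Q_def)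
  finally show ?thesis .
qed

lemma CFQ_quot: "CFQ quot gens"
proof -
  \<comment> \<open>The projections undo \<open>marked_code\<close>: group order, code of the table,
    and the images of the three generators.\<close>
  define P where "P z \<longleftrightarrow> table_check (pfst z) (pfst (psnd z))
      (lnth 0 (psnd (psnd z))) (lnth 1 (psnd (psnd z))) (lnth 2 (psnd (psnd z)))" for z
  have "decidable P"
    unfolding P_def by (intro decidable_table_check computability_intros)
  then have "computable (\<lambda>z. if P z then 1 else 0)" by (simp add: decidable_def)
  moreover have "(if P (marked_code m t fs) then 1 else 0) = (1::nat) \<longleftrightarrow>
      extends_hom quot gens (table_monoid m t) fs"
    if v: "valid_marked (length gens) m t fs" for m t fs
  proof -
    have grp: "group (table_monoid m t)" and len: "length t = m * m"
      and fs3: "length fs = 3" and fsm: "set fs \<subseteq> {0..<m}"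
      using v by (auto simp: valid_marked_def)
    obtain a b c where fs: "fs = [a, b, c]"
      using fs3 by (auto simp: length_Suc_conv numeral_3_eq_3)
    have "P (marked_code m t fs) \<longleftrightarrow> table_check m (list_encode t) a b c"
      by (simp add: P_def marked_code_def fs del: list_encode.simps)
    also have "\<dots> \<longleftrightarrow> extends_hom quot gens (table_monoid m t) fs"
      using extends_hom_iff[OF grp _ fs3] table_check_correct[OF grp len] fsm
      by (simp add: fs table_monoid_def)
    finally show ?thesis by simp
  qed
  ultimately show ?thesis unfolding CFQ_def by blast
qed

theorem theorem2:
  shows "\<exists>(G :: nat monoid) (s :: nat list).
           group G \<and> distinct s \<and> set s \<subseteq> carrier G \<and> generate G (set s) = carrier G \<and>
           residually_finite G \<and> CFQ G s \<and> \<not> solvable_WP G s"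
  using group_quot distinct_gens set_gens generate_gens residually_finite_quot CFQ_quot
    not_solvable_WP_quot by blast

end
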